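(* Let $a>0$, and let $\xi_a(\lambda)$ be the spectral shift function for the pair $H_1,H_a$. Then $\xi_a(\lambda)$ is an odd function of $\lambda\in\mathbb{R}$ and the following holds. (i) Let $a\in(0,\sqrt2)$. Then $$\xi_a(\lambda)=\frac1\pi\arctan\frac{2(a^2-1)\lambda\sqrt{1-\lambda^2}}{1+(1-a^2)(2\lambda^2-1)},\qquad\lambda\in[0,1),$$ and $\xi_a(\lambda)=0$ for $\lambda\ge1$. (ii) Let $a>\sqrt2$ and $\lambda_+(a)=\dfrac{a^2}{2\sqrt{a^2-1}}$. Then $$\xi_a(\lambda)=\frac1\pi\operatorname{arccot}\frac{1-(a^2-1)(2\lambda^2-1)}{2(a^2-1)\lambda\sqrt{1-\lambda^2}},\qquad\lambda\in[0,1)$$ (for $\lambda=0$ the right-hand side is understood as its limit $0$ as $\lambda\to+0$), $\xi_a(\lambda)=1$ for $\lambda\in[1,\lambda_+(a))$, and $\xi_a(\lambda)=0$ for $\lambda>\lambda_+(a)$. (iii) For $a=\sqrt2$, $$\xi_{\sqrt2}(\lambda)=\frac1\pi\arctan\frac{\lambda}{\sqrt{1-\lambda^2}},\qquad\lambda\in[0,1),$$ $\xi_{\sqrt2}(\lambda)\to1/2$ as $\lambda\to1$ with $\lambda<1$, and $\xi_{\sqrt2}(\lambda)=0$ for $\lambda>1$.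
   Context: $\mathbb{Z}_+=\{0,1,2,\dots\}$ and $(e_n)_{n\ge0}$ is the canonical orthonormal basis of $\ell^2(\mathbb{Z}_+)$. For $a>0$, $H_a$ is the bounded self-adjoint operator on $\ell^2(\mathbb{Z}_+)$ given by $$H_ae_0=\tfrac a2e_1,\qquad H_ae_1=\tfrac12(ae_0+e_2),\qquad H_ae_n=\tfrac12(e_{n-1}+e_{n+1})\ \ (n\ge2).$$ Put $V_a=H_a-H_1$ (a rank two operator if $a\ne1$), $R_1(z)=(H_1-zI)^{-1}$. The perturbation determinant is $D_a(z)=\operatorname{Det}(I+V_aR_1(z))$, $z\in\mathbb{C}\setminus[-1,1]$. It is nonzero for $\operatorname{Im}z\neq0$ and tends to $1$ as $|z|\to\infty$; for $\operatorname{Im}z>0$ the continuous branch of $\arg D_a(z)$ is fixed by $\arg D_a(z)\to0$ as $|z|\to\infty$. The spectral shift function is $$\xi_a(\lambda)=\pi^{-1}\lim_{\varepsilon\to+0}\arg D_a(\lambda+i\varepsilon),\qquad\lambda\in\mathbb{R}.$$ Here $\arctan$ takes values in $(-\pi/2,\pi/2)$ and $\operatorname{arccot}$ takes values in $(0,\pi)$. *)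

theory Defs
  imports "HOL-Analysis.Inner_Product" "Jordan_Normal_Form.Determinant"
begin

section \<open>Square summable complex sequences\<close>

typedef ell2 = "{x :: nat \<Rightarrow> complex. summable (\<lambda>n. (cmod (x n))\<^sup>2)}"
  morphisms coord Abs_ell2
  by (rule exI[of _ "\<lambda>_. 0"]) simp

setup_lifting type_definition_ell2

lemma ell2_eqI: "(\<And>n. coord x n = coord y n) \<Longrightarrow> x = y"
  by (metis coord_inject ext)

lemma summable_coord: "summable (\<lambda>n. (cmod (coord x n))\<^sup>2)"
  using coord by auto

lemma cmod_add_square_le: "(cmod (u + v))\<^sup>2 \<le> 2 * (cmod u)\<^sup>2 + 2 * (cmod v)\<^sup>2"
proof -
  have "(cmod (u + v))\<^sup>2 \<le> (cmod u + cmod v)\<^sup>2"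
    by (intro power_mono norm_triangle_ineq) auto
  also have "\<dots> \<le> 2 * (cmod u)\<^sup>2 + 2 * (cmod v)\<^sup>2"
    using sum_squares_bound[of "cmod u" "cmod v"] by (simp add: power2_sum)
  finally show ?thesis .
qed

lemma square_summable_add:
  assumes "summable (\<lambda>n. (cmod (x n))\<^sup>2)" "summable (\<lambda>n. (cmod (y n))\<^sup>2)"
  shows "summable (\<lambda>n. (cmod (x n + y n))\<^sup>2)"
proof (rule summable_comparison_test')
  show "summable (\<lambda>n. 2 * (cmod (x n))\<^sup>2 + 2 * (cmod (y n))\<^sup>2)"
    using assms by (intro summable_add summable_mult)
  show "norm ((cmod (x n + y n))\<^sup>2) \<le> 2 * (cmod (x n))\<^sup>2 + 2 * (cmod (y n))\<^sup>2" if "n \<ge> 0" for n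
    using cmod_add_square_le[of "x n" "y n"] by simp
qed

lemma square_summable_mult:
  assumes "summable (\<lambda>n. (cmod (x n))\<^sup>2)"
  shows "summable (\<lambda>n. (cmod (c * x n))\<^sup>2)"
  using summable_mult[OF assms, of "(cmod c)\<^sup>2"] by (simp add: norm_mult power_mult_distrib)

lemma summable_mult_cnj:
  assumes "summable (\<lambda>n. (cmod (x n))\<^sup>2)" "summable (\<lambda>n. (cmod (y n))\<^sup>2)"
  shows "summable (\<lambda>n. x n * cnj (y n))"
proof (rule summable_comparison_test')
  show "summable (\<lambda>n. (cmod (x n))\<^sup>2 + (cmod (y n))\<^sup>2)"
    using assms by (rule summable_add)
  show "norm (x n * cnj (y n)) \<le> (cmod (x n))\<^sup>2 + (cmod (y n))\<^sup>2" if "n \<ge> 0" for n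
  proof -
    have "2 * (cmod (x n) * cmod (y n)) \<le> (cmod (x n))\<^sup>2 + (cmod (y n))\<^sup>2"
      using sum_squares_bound[of "cmod (x n)" "cmod (y n)"] by simp
    moreover have "0 \<le> cmod (x n) * cmod (y n)" by simp
    ultimately show ?thesis unfolding norm_mult complex_mod_cnj by linarith
  qed
qed

lift_definition scaleC :: "complex \<Rightarrow> ell2 \<Rightarrow> ell2" is "\<lambda>c x n. c * x n"
  by (simp add: square_summable_mult)

definition cinner :: "ell2 \<Rightarrow> ell2 \<Rightarrow> complex"
  where "cinner x y = (\<Sum>n. coord x n * cnj (coord y n))"

instantiation ell2 :: real_inner
begin

lift_definition zero_ell2 :: ell2 is "\<lambda>_. 0" by simp

lift_definition plus_ell2 :: "ell2 \<Rightarrow> ell2 \<Rightarrow> ell2" is "\<lambda>x y n. x n + y n"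
  by (simp add: square_summable_add)

lift_definition uminus_ell2 :: "ell2 \<Rightarrow> ell2" is "\<lambda>x n. - x n" by simp

definition minus_ell2 :: "ell2 \<Rightarrow> ell2 \<Rightarrow> ell2"
  where "minus_ell2 x y = x + - y"

definition scaleR_ell2 :: "real \<Rightarrow> ell2 \<Rightarrow> ell2"
  where "scaleR_ell2 r x = scaleC (of_real r) x"

definition inner_ell2 :: "ell2 \<Rightarrow> ell2 \<Rightarrow> real"
  where "inner_ell2 x y = Re (cinner x y)"

definition norm_ell2 :: "ell2 \<Rightarrow> real"
  where "norm_ell2 x = sqrt (inner x x)"

definition sgn_ell2 :: "ell2 \<Rightarrow> ell2"
  where "sgn_ell2 x = scaleR (inverse (norm x)) x"

definition dist_ell2 :: "ell2 \<Rightarrow> ell2 \<Rightarrow> real"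
  where "dist_ell2 x y = norm (x - y)"

definition uniformity_ell2 :: "(ell2 \<times> ell2) filter"
  where "uniformity_ell2 = (INF e\<in>{0<..}. principal {(x, y). dist x y < e})"

definition open_ell2 :: "ell2 set \<Rightarrow> bool"
  where "open_ell2 U = (\<forall>x\<in>U. eventually (\<lambda>(x', y). x' = x \<longrightarrow> y \<in> U) uniformity)"

lemma cinner_summable: "summable (\<lambda>n. coord x n * cnj (coord y n))"
  by (intro summable_mult_cnj summable_coord)

lemma cinner_self: "cinner x x = of_real (\<Sum>n. (cmod (coord x n))\<^sup>2)"
proof -
  have "cinner x x = (\<Sum>n. of_real ((cmod (coord x n))\<^sup>2))"
    unfolding cinner_def by (metis complex_norm_square)
  then show ?thesis
    using suminf_of_real[OF summable_coord, of x, where ?'a = complex] by simp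
qed

instance
proof
  fix x y z :: ell2 and r s :: real
  show "x - y = x + - y" by (rule minus_ell2_def)
  show "x + y + z = x + (y + z)" by transfer (simp add: add.assoc)
  show "x + y = y + x" by transfer (simp add: add.commute)
  show "0 + x = x" by transfer simp
  show "- x + x = 0" by transfer simp
  show "r *\<^sub>R (x + y) = r *\<^sub>R x + r *\<^sub>R y"
    unfolding scaleR_ell2_def by transfer (simp add: algebra_simps)
  show "(r + s) *\<^sub>R x = r *\<^sub>R x + s *\<^sub>R x"
    unfolding scaleR_ell2_def by transfer (simp add: algebra_simps)
  show "r *\<^sub>R s *\<^sub>R x = (r * s) *\<^sub>R x"
    unfolding scaleR_ell2_def by transfer (simp add: algebra_simps)
  show "1 *\<^sub>R x = x"
    unfolding scaleR_ell2_def by transfer simp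
  show "dist x y = norm (x - y)" by (rule dist_ell2_def)
  show "sgn x = scaleR (inverse (norm x)) x" by (rule sgn_ell2_def)
  show "uniformity = (INF e\<in>{0<..}. principal {(x :: ell2, y). dist x y < e})"
    by (rule uniformity_ell2_def)
  show "open U = (\<forall>x\<in>U. eventually (\<lambda>(x', y). x' = x \<longrightarrow> y \<in> U) uniformity)" for U :: "ell2 set"
    by (rule open_ell2_def)
  have "cinner y x = cnj (cinner x y)"
    using bounded_linear.suminf[OF bounded_linear_cnj cinner_summable[of x y]]
    unfolding cinner_def by (simp add: mult.commute)
  then show "inner x y = inner y x" by (simp add: inner_ell2_def)
  have "cinner (x + y) z = cinner x z + cinner y z"
    unfolding cinner_def
    using suminf_add[OF cinner_summable[of x z] cinner_summable[of y z]]
    by (simp add: plus_ell2.rep_eq algebra_simps)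
  then show "inner (x + y) z = inner x z + inner y z" by (simp add: inner_ell2_def)
  have "cinner (r *\<^sub>R x) y = of_real r * cinner x y"
    unfolding cinner_def
    using suminf_mult[OF cinner_summable[of x y], of "of_real r"]
    by (simp add: scaleR_ell2_def scaleC.rep_eq algebra_simps)
  then show "inner (r *\<^sub>R x) y = r * inner x y" by (simp add: inner_ell2_def)
  show "0 \<le> inner x x"
    by (simp add: inner_ell2_def cinner_self suminf_nonneg summable_coord)
  have "inner x x = 0 \<longleftrightarrow> (\<forall>n. (cmod (coord x n))\<^sup>2 = 0)"
    using suminf_eq_zero_iff[OF summable_coord, of x] by (simp add: inner_ell2_def cinner_self)
  also have "\<dots> \<longleftrightarrow> x = 0"
    by (auto intro!: ell2_eqI simp: zero_ell2.rep_eq)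
  finally show "inner x x = 0 \<longleftrightarrow> x = 0" .
  show "norm x = sqrt (inner x x)" by (rule norm_ell2_def)
qed

end

lemma coord_minus: "coord (x - y) n = coord x n - coord y n"
  unfolding minus_ell2_def plus_ell2.rep_eq uminus_ell2.rep_eq by simp

lemma coord_scaleR: "coord (r *\<^sub>R x) n = of_real r * coord x n"
  by (simp add: scaleR_ell2_def scaleC.rep_eq)

lemmas coord_simps [simp] = zero_ell2.rep_eq plus_ell2.rep_eq uminus_ell2.rep_eq
  scaleC.rep_eq coord_minus coord_scaleR

lemma norm_ell2_square: "(norm x)\<^sup>2 = (\<Sum>n. (cmod (coord x n))\<^sup>2)"
  by (simp add: power2_norm_eq_inner inner_ell2_def cinner_self)

lift_definition ebasis :: "nat \<Rightarrow> ell2" is "\<lambda>k n. if n = k then 1 else 0"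
proof -
  fix k :: nat
  show "summable (\<lambda>n. (cmod (if n = k then 1 else 0))\<^sup>2)"
    by (rule summable_finite[of "{k}"]) auto
qed

lemma coord_ebasis [simp]: "coord (ebasis k) n = (if n = k then 1 else 0)"
  by (simp add: ebasis.rep_eq)

lemma cinner_ebasis: "cinner x (ebasis k) = coord x k"
proof -
  have "cinner x (ebasis k) = (\<Sum>n\<in>{k}. coord x n * cnj (coord (ebasis k) n))"
    unfolding cinner_def by (rule suminf_finite) auto
  then show ?thesis by simp
qed

section \<open>The operators\<close>

lift_definition Hop :: "real \<Rightarrow> ell2 \<Rightarrow> ell2" is
  "\<lambda>a x n. if n = 0 then of_real (a / 2) * x 1
           else if n = 1 then 1 / 2 * (of_real a * x 0 + x 2)
           else 1 / 2 * (x (n - 1) + x (n + 1))"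
proof -
  fix a :: real and x :: "nat \<Rightarrow> complex"
  let ?h = "\<lambda>n. if n = 0 then of_real (a / 2) * x 1
           else if n = 1 then 1 / 2 * (of_real a * x 0 + x 2)
           else 1 / 2 * (x (n - 1) + x (n + 1))"
  assume x: "summable (\<lambda>n. (cmod (x n))\<^sup>2)"
  have "summable (\<lambda>n. (cmod (x (n + 1)))\<^sup>2)" "summable (\<lambda>n. (cmod (x (n + 3)))\<^sup>2)"
    by (rule iffD2[OF summable_iff_shift[where f = "\<lambda>n. (cmod (x n))\<^sup>2"] x])+
  from square_summable_mult[OF square_summable_add[OF this], of "1 / 2"]
  have "summable (\<lambda>n. (cmod (?h (n + 2)))\<^sup>2)"
    by (simp add: numeral_3_eq_3)
  then show "summable (\<lambda>n. (cmod (?h n))\<^sup>2)"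
    by (rule iffD1[OF summable_iff_shift[where f = "\<lambda>n. (cmod (?h n))\<^sup>2"]])
qed

lemma coord_Hop: "coord (Hop a x) n =
    (if n = 0 then of_real (a / 2) * coord x 1
     else if n = 1 then 1 / 2 * (of_real a * coord x 0 + coord x 2)
     else 1 / 2 * (coord x (n - 1) + coord x (n + 1)))"
  by transfer simp

lemma Hop_ebasis:
  "Hop a (ebasis 0) = scaleC (of_real (a / 2)) (ebasis 1)"
  "Hop a (ebasis 1) = scaleC (1 / 2) (scaleC (of_real a) (ebasis 0) + ebasis 2)"
  "n \<ge> 2 \<Longrightarrow> Hop a (ebasis n) = scaleC (1 / 2) (ebasis (n - 1) + ebasis (n + 1))"
  by (rule ell2_eqI; auto simp: coord_Hop)+

lemma Hop_add: "Hop a (x + y) = Hop a x + Hop a y"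
  by (rule ell2_eqI) (auto simp: coord_Hop algebra_simps)

lemma Hop_scaleC: "Hop a (scaleC c x) = scaleC c (Hop a x)"
  by (rule ell2_eqI) (auto simp: coord_Hop algebra_simps)

lemma Hop_bounded_linear: "bounded_linear (Hop a)"
proof (rule bounded_linear_intro[where K = "1 + \<bar>a\<bar>"])
  fix x y :: ell2 and r :: real
  show "Hop a (x + y) = Hop a x + Hop a y" by (rule Hop_add)
  show "Hop a (r *\<^sub>R x) = r *\<^sub>R Hop a x" by (simp add: scaleR_ell2_def Hop_scaleC)
  define M where "M = 1 + \<bar>a\<bar>"
  define p where "p n = (if n = 0 then 0 else (cmod (coord x (n - 1)))\<^sup>2)" for n
  define s where "s n = (cmod (coord x (Suc n)))\<^sup>2" for n
  let ?t = "\<lambda>n. (cmod (coord x n))\<^sup>2"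
  have st: "summable ?t" by (rule summable_coord)
  have ss: "summable s" unfolding s_def using st by (subst summable_Suc_iff)
  have "p sums suminf ?t"
    using sums_Suc[of p "suminf ?t"] st by (simp add: p_def summable_sums)
  then have sp: "summable p" and pt: "suminf p = suminf ?t" by (auto simp: sums_iff)
  have s_le: "suminf s \<le> suminf ?t"
    using suminf_split_head[OF st] unfolding s_def by (metis diff_le_eq le_add_same_cancel1 zero_le_power2)
  define w :: "nat \<Rightarrow> complex" where "w n = (if n = 0 then of_real (a / 2) else 1 / 2)" for n
  have w: "(cmod (w n))\<^sup>2 \<le> M\<^sup>2 / 4" for n
  proof -
    have "cmod (w n) \<le> M / 2" by (auto simp: w_def M_def norm_divide)
    from power_mono[OF this, of 2] show ?thesis by (simp add: power_divide)
  qed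
  have bound: "(cmod (coord (Hop a x) n))\<^sup>2 \<le> M\<^sup>2 / 2 * (p n + s n)" for n
  proof -
    let ?u = "w n * coord x (Suc n)" and ?v = "if n = 0 then 0 else w (n - 1) * coord x (n - 1)"
    have "coord (Hop a x) n = ?u + ?v"
      by (cases n) (auto simp: coord_Hop w_def algebra_simps numeral_2_eq_2)
    then have "(cmod (coord (Hop a x) n))\<^sup>2 \<le> 2 * (cmod ?u)\<^sup>2 + 2 * (cmod ?v)\<^sup>2"
      using cmod_add_square_le[of ?u ?v] by simp
    moreover have "(cmod ?u)\<^sup>2 \<le> M\<^sup>2 / 4 * s n"
      unfolding norm_mult power_mult_distrib s_def by (intro mult_right_mono w) simp
    moreover have "(cmod ?v)\<^sup>2 \<le> M\<^sup>2 / 4 * p n"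
    proof (cases "n = 0")
      case False
      then have "(cmod ?v)\<^sup>2 = (cmod (w (n - 1)))\<^sup>2 * p n"
        by (simp add: norm_mult power_mult_distrib p_def)
      also have "\<dots> \<le> M\<^sup>2 / 4 * p n"
        by (intro mult_right_mono w) (simp add: p_def)
      finally show ?thesis .
    qed (simp add: p_def)
    ultimately show ?thesis by (simp add: algebra_simps)
  qed
  have "(norm (Hop a x))\<^sup>2 \<le> (\<Sum>n. M\<^sup>2 / 2 * (p n + s n))"
    unfolding norm_ell2_square
    by (intro suminf_le bound summable_coord summable_mult summable_add sp ss refl)
  also have "\<dots> = M\<^sup>2 / 2 * (suminf p + suminf s)"
    using suminf_mult[OF summable_add[OF sp ss], of "M\<^sup>2 / 2"] suminf_add[OF sp ss] by simp
  also have "\<dots> \<le> M\<^sup>2 / 2 * (2 * suminf ?t)"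
    using s_le pt by (intro mult_left_mono) auto
  also have "\<dots> = (norm x * M)\<^sup>2"
    by (simp add: power_mult_distrib norm_ell2_square)
  finally show "norm (Hop a x) \<le> norm x * (1 + \<bar>a\<bar>)"
    unfolding M_def by (rule power2_le_imp_le) simp
qed

lemma Hop_self_adjoint: "cinner (Hop a x) y = cinner x (Hop a y)"
proof -
  let ?w = "\<lambda>n. if n = 0 then of_real (a / 2) else 1 / 2 :: complex"
  define u where "u n = ?w n * coord x (Suc n) * cnj (coord y n)" for n
  define v where "v n = ?w n * coord x n * cnj (coord y (Suc n))" for n
  have split: "coord (Hop a x) n = ?w n * coord x (Suc n) + (if n = 0 then 0 else ?w (n - 1) * coord x (n - 1))"
    for n x by (cases n) (auto simp: coord_Hop algebra_simps numeral_2_eq_2)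
  have xs: "summable (\<lambda>n. (cmod (coord z (Suc n)))\<^sup>2)" for z
    using summable_coord[of z] by (subst summable_Suc_iff)
  have "summable (\<lambda>n. coord x (Suc n) * cnj (coord y n))" "summable (\<lambda>n. coord x n * cnj (coord y (Suc n)))"
    by (intro summable_mult_cnj xs summable_coord)+
  then have "summable (\<lambda>n. coord x (Suc (Suc n)) * cnj (coord y (Suc n)))"
            "summable (\<lambda>n. coord x (Suc n) * cnj (coord y (Suc (Suc n))))"
    by (auto simp: summable_Suc_iff[where f = "\<lambda>n. coord x (Suc n) * cnj (coord y n)"]
                   summable_Suc_iff[where f = "\<lambda>n. coord x n * cnj (coord y (Suc n))"])
  from this[THEN summable_mult, of "1 / 2"]
  have "summable (\<lambda>n. u (Suc n))" "summable (\<lambda>n. v (Suc n))"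
    by (simp_all add: u_def v_def mult.assoc)
  then have su: "summable u" and sv: "summable v"
    by (simp_all add: summable_Suc_iff)
  have shift: "suminf (\<lambda>n. if n = 0 then 0 else f (n - 1)) = suminf f"
    "summable (\<lambda>n. if n = 0 then 0 else f (n - 1))" if "summable f" for f :: "nat \<Rightarrow> complex"
  proof -
    have "(\<lambda>n. if n = 0 then 0 else f (n - 1)) sums (suminf f + 0)"
      using sums_Suc[of "\<lambda>n. if n = 0 then 0 else f (n - 1)" "suminf f"] summable_sums[OF that]
      by simp
    then show "suminf (\<lambda>n. if n = 0 then 0 else f (n - 1)) = suminf f"
      "summable (\<lambda>n. if n = 0 then 0 else f (n - 1))"
      by (simp_all add: sums_iff)
  qed
  have "cinner (Hop a x) y = (\<Sum>n. u n + (if n = 0 then 0 else v (n - 1)))"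
    unfolding cinner_def
    by (intro suminf_cong) (auto simp: split u_def v_def algebra_simps)
  also have "\<dots> = suminf u + suminf v"
    using suminf_add[OF su shift(2)[OF sv]] shift(1)[OF sv] by simp
  also have "\<dots> = (\<Sum>n. v n + (if n = 0 then 0 else u (n - 1)))"
    using suminf_add[OF sv shift(2)[OF su]] shift(1)[OF su] by (simp add: add.commute)
  also have "\<dots> = cinner x (Hop a y)"
    unfolding cinner_def
    by (intro suminf_cong) (auto simp: split u_def v_def algebra_simps)
  finally show ?thesis .
qed

definition Vop :: "real \<Rightarrow> ell2 \<Rightarrow> ell2"
  where "Vop a x = Hop a x - Hop 1 x"

text \<open>For z outside \<open>[-1, 1]\<close> the map \<open>Hop 1 - z I\<close> is a bijection of \<^typ>\<open>ell2\<close> and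
  \<^term>\<open>inv_into UNIV\<close> gives its genuine inverse; elsewhere the value has no meaning.\<close>

definition Rop :: "complex \<Rightarrow> ell2 \<Rightarrow> ell2"
  where "Rop z = inv_into UNIV (\<lambda>x. Hop 1 x - scaleC z x)"

section \<open>Fredholm determinants\<close>

text \<open>\<open>Det (I + A)\<close> for a trace class operator \<open>A\<close>, as the limit of the determinants of the finite
  sections of \<open>I + A\<close> in the canonical basis. If \<open>A\<close> has finite rank with range in the span of the
  first N basis vectors, the sequence is eventually constant, equal to the determinant of
  \<open>I + A\<close> restricted to that span (lemma \<open>Det_finite_rank\<close>).\<close>

definition section_mat :: "(ell2 \<Rightarrow> ell2) \<Rightarrow> nat \<Rightarrow> complex mat"
  where "section_mat B N = mat N N (\<lambda>(i, j). cinner (B (ebasis j)) (ebasis i))"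

definition Det :: "(ell2 \<Rightarrow> ell2) \<Rightarrow> complex"
  where "Det B = lim (\<lambda>N. det (section_mat B N))"

lemma Det_finite_rank:
  assumes "\<And>x n. n \<ge> N \<Longrightarrow> coord (A x) n = 0"
  shows "Det (\<lambda>x. x + A x) = det (section_mat (\<lambda>x. x + A x) N)"
proof -
  let ?S = "section_mat (\<lambda>x. x + A x)"
  have step: "det (?S (Suc M)) = det (?S M)" if "N \<le> M" for M
  proof -
    have row: "?S (Suc M) $$ (M, j) = (if j = M then 1 else 0)" if "j < Suc M" for j
      using that \<open>N \<le> M\<close> by (auto simp: section_mat_def cinner_ebasis assms)
    have "det (?S (Suc M)) = (\<Sum>j<Suc M. ?S (Suc M) $$ (M, j) * cofactor (?S (Suc M)) M j)"
      by (rule laplace_expansion_row) (auto simp: section_mat_def)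
    also have "\<dots> = (\<Sum>j<Suc M. if j = M then cofactor (?S (Suc M)) M M else 0)"
      by (intro sum.cong refl) (auto simp: row)
    also have "\<dots> = cofactor (?S (Suc M)) M M"
      by simp
    also have "mat_delete (?S (Suc M)) M M = ?S M"
      by (rule eq_matI) (auto simp: mat_delete_def section_mat_def)
    then have "cofactor (?S (Suc M)) M M = det (?S M)"
      by (simp add: cofactor_def)
    finally show ?thesis .
  qed
  have "det (?S M) = det (?S N)" if "N \<le> M" for M
    using that by (induction M rule: dec_induct) (auto simp: step)
  then have "\<forall>\<^sub>F M in sequentially. det (?S M) = det (?S N)"
    unfolding eventually_sequentially by blast
  then have "(\<lambda>M. det (?S M)) \<longlonglongrightarrow> det (?S N)"
    by (rule tendsto_eventually)
  then show ?thesis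
    unfolding Det_def by (rule limI)
qed

definition Dpert :: "real \<Rightarrow> complex \<Rightarrow> complex"
  where "Dpert a z = Det (\<lambda>x. x + Vop a (Rop z x))"

section \<open>The spectral shift function\<close>

text \<open>The three conditions determine the branch uniquely on the open upper half plane, which is
  connected; its values elsewhere are arbitrary and never used.\<close>

definition argD :: "real \<Rightarrow> complex \<Rightarrow> real"
  where "argD a = (SOME \<theta>. continuous_on {z. Im z > 0} \<theta> \<and>
      (\<forall>z. Im z > 0 \<longrightarrow> Dpert a z = of_real (cmod (Dpert a z)) * cis (\<theta> z)) \<and>
      (\<theta> \<longlongrightarrow> 0) (inf at_infinity (principal {z. Im z > 0})))"

definition ssf :: "real \<Rightarrow> real \<Rightarrow> real"
  where "ssf a x = 1 / pi * Lim (at_right 0) (\<lambda>\<epsilon>. argD a (Complex x \<epsilon>))"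

definition arccot :: "real \<Rightarrow> real"
  where "arccot y = (THE x. 0 < x \<and> x < pi \<and> cot x = y)"

definition lambda_plus :: "real \<Rightarrow> real"
  where "lambda_plus a = a\<^sup>2 / (2 * sqrt (a\<^sup>2 - 1))"

end

theory Submission
  imports Defs "HOL-Analysis.Complex_Transcendental"
begin

text \<open>In the coordinate \<open>w\<close> of the open unit disc given by \<open>2 z = w + 1 / w\<close>, the resolvent of
  \<open>H\<^sub>1\<close> acts on \<open>e\<^sub>0\<close> as \<open>-2 w (w\<^sup>n)\<^sub>n\<close>, and the perturbation determinant reduces to a two by two
  determinant with value \<open>1 - (a\<^sup>2 - 1) w\<^sup>2\<close>. If \<open>a\<^sup>2 \<le> 2\<close> it stays in the right half plane; if
  \<open>a\<^sup>2 > 1\<close> it splits into two linear factors, one in the upper and one in the lower half plane.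
  Either way the branch of the argument is a sum of principal values, whose limits on the real
  axis can be read off.\<close>

section \<open>The inverse of the Joukowski map\<close>

text \<open>For \<open>a\<^sup>2 > 2\<close> the factor \<open>1 - s w\<close> has the zero
  \<open>w = 1 / s\<close> inside the unit disc, which corresponds to
  \<open>z = (s + 1 / s) / 2 = lambda_plus a\<close>. The value 1 of the shift function on
  \<open>[1, lambda_plus a)\<close> is the jump by pi of the argument of this factor across its
  zero. The obstacle is oddness, which is claimed at every real point. \<open>Lim\<close> carries no
  information where the limit fails to exist, so convergence has to be proved even where the
  determinant tends to zero: at 1 for \<open>a\<^sup>2 = 2\<close>, at \<open>lambda_plus a\<close>
  for \<open>a\<^sup>2 > 2\<close>, and at their mirror images. Evaluation on the boundary is
  impossible there; a positive factor depending on \<epsilon> is split off, which leaves the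
  argument unchanged and gives a nonzero limit.\<close>

text \<open>On the closed upper half plane this is the square root with values in the first quadrant. Unlike
  \<^const>\<open>csqrt\<close> it is continuous everywhere, so that boundary values are plain evaluations.\<close>

definition usqrt :: "complex \<Rightarrow> complex"
  where "usqrt z = Complex (sqrt ((cmod z + Re z) / 2)) (sqrt ((cmod z - Re z) / 2))"

lemma continuous_on_usqrt [continuous_intros]:
  "continuous_on S f \<Longrightarrow> continuous_on S (\<lambda>x. usqrt (f x))"
  unfolding usqrt_def by (intro continuous_intros) auto

text \<open>The imaginary part of the square comes out as the root of \<open>(Im z)\<^sup>2\<close>,
  that is \<open>\<bar>Im z\<bar>\<close>; the sign condition turns this into
  \<open>Im z\<close>.\<close>

lemma usqrt_square:
  assumes "Im z \<ge> 0"
  shows "(usqrt z)\<^sup>2 = z"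
proof -
  have nonneg: "cmod z + Re z \<ge> 0" "cmod z - Re z \<ge> 0"
    using abs_Re_le_cmod[of z] by auto
  have "2 * (sqrt (s / 2) * sqrt (t / 2)) = sqrt (s * t)" for s t
    by (simp add: real_sqrt_mult real_sqrt_divide)
  then have "2 * (sqrt ((cmod z + Re z) / 2) * sqrt ((cmod z - Re z) / 2)) = sqrt ((cmod z + Re z) * (cmod z - Re z))" .
  also have "(cmod z + Re z) * (cmod z - Re z) = (Im z)\<^sup>2"
    using cmod_power2[of z] by (simp add: algebra_simps power2_eq_square)
  finally show ?thesis
    using assms nonneg by (intro complex_eqI) (simp_all add: usqrt_def power2_eq_square field_simps)
qed

lemma usqrt_first_quadrant:
  assumes "Im z > 0"
  shows "Re (usqrt z) > 0" "Im (usqrt z) > 0"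
proof -
  have "\<bar>Re z\<bar> < cmod z"
    using assms by (intro power_less_imp_less_base[of "\<bar>Re z\<bar>" 2]) (simp_all add: cmod_power2)
  then show "Re (usqrt z) > 0" "Im (usqrt z) > 0"
    by (auto simp: usqrt_def)
qed

lemma usqrt_of_real: "x \<ge> 0 \<Longrightarrow> usqrt (of_real x) = of_real (sqrt x)"
  "x \<le> 0 \<Longrightarrow> usqrt (of_real x) = \<i> * of_real (sqrt (- x))"
  by (simp_all add: usqrt_def complex_eq_iff)

lemma usqrt_imaginary: "y \<ge> 0 \<Longrightarrow> usqrt (Complex 0 y) = of_real (sqrt y) * usqrt \<i>"
  by (simp add: usqrt_def complex_eq_iff complex_norm real_sqrt_divide)

text \<open>Let p and q be the two roots. For \<open>Im z \<ge> 0\<close> one has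
  \<open>p\<^sup>2 + q\<^sup>2 = 2 z\<close>, so this is \<open>z - p q\<close>, the familiar
  \<open>z - sqrt (z\<^sup>2 - 1)\<close> with the branch fixed by p and q. In the open half plane
  it is the root of smaller modulus of \<open>w\<^sup>2 - 2 z w + 1\<close>.\<close>

definition joukowski_inv :: "complex \<Rightarrow> complex"
  where "joukowski_inv z = (usqrt (z + 1) - usqrt (z - 1))\<^sup>2 / 2"

lemma continuous_on_joukowski_inv [continuous_intros]:
  "continuous_on S f \<Longrightarrow> continuous_on S (\<lambda>x. joukowski_inv (f x))"
  unfolding joukowski_inv_def by (intro continuous_intros) auto

lemma joukowski_inv_mult:
  assumes "Im z \<ge> 0"
  shows "joukowski_inv z * ((usqrt (z + 1) + usqrt (z - 1))\<^sup>2 / 2) = 1"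
proof -
  let ?p = "usqrt (z + 1)" and ?q = "usqrt (z - 1)"
  have "joukowski_inv z * ((?p + ?q)\<^sup>2 / 2) = ((?p\<^sup>2 - ?q\<^sup>2) / 2)\<^sup>2"
    by (simp add: joukowski_inv_def power2_eq_square algebra_simps)
  also have "\<dots> = 1"
    using assms by (simp add: usqrt_square)
  finally show ?thesis .
qed

lemma joukowski_inv_nonzero: "Im z \<ge> 0 \<Longrightarrow> joukowski_inv z \<noteq> 0"
  using joukowski_inv_mult[of z] by auto

lemma inverse_joukowski_inv:
  assumes "Im z \<ge> 0"
  shows "inverse (joukowski_inv z) = (usqrt (z + 1) + usqrt (z - 1))\<^sup>2 / 2"
  by (rule inverse_unique[OF joukowski_inv_mult[OF assms]])

lemma joukowski_inv_add_inverse: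
  assumes "Im z \<ge> 0"
  shows "joukowski_inv z + inverse (joukowski_inv z) = 2 * z"
proof -
  let ?p = "usqrt (z + 1)" and ?q = "usqrt (z - 1)"
  have "joukowski_inv z + inverse (joukowski_inv z) = ?p\<^sup>2 + ?q\<^sup>2"
    unfolding inverse_joukowski_inv[OF assms]
    by (simp add: joukowski_inv_def power2_eq_square field_simps)
  then show ?thesis
    using assms by (simp add: usqrt_square)
qed

lemma joukowski_inv_quadratic:
  assumes "Im z \<ge> 0"
  shows "(joukowski_inv z)\<^sup>2 + 1 = 2 * z * joukowski_inv z"
  unfolding joukowski_inv_add_inverse[OF assms, symmetric]
  using joukowski_inv_nonzero[OF assms] by (simp add: algebra_simps power2_eq_square)

text \<open>Both square roots p and q lie in the open first quadrant, so their real inner product is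
  positive and \<open>cmod (p - q) < cmod (p + q)\<close>. Half the squares of these numbers are the
  moduli of \<open>w\<close> and \<open>1 / w\<close>.\<close>

lemma cmod_joukowski_inv_less_1:
  assumes "Im z > 0"
  shows "cmod (joukowski_inv z) < 1"
proof -
  define p q where "p = usqrt (z + 1)" and "q = usqrt (z - 1)"
  have pos: "Re p > 0" "Im p > 0" "Re q > 0" "Im q > 0"
    using assms usqrt_first_quadrant[of "z + 1"] usqrt_first_quadrant[of "z - 1"]
    by (auto simp: p_def q_def)
  have "(cmod (p - q))\<^sup>2 < (cmod (p + q))\<^sup>2"
    unfolding cmod_power2 using mult_pos_pos[OF pos(1,3)] mult_pos_pos[OF pos(2,4)]
    by (simp add: power2_eq_square algebra_simps)
  moreover have "cmod (joukowski_inv z) = (cmod (p - q))\<^sup>2 / 2"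
    by (simp add: joukowski_inv_def norm_divide norm_power p_def q_def)
  moreover have "cmod (inverse (joukowski_inv z)) = (cmod (p + q))\<^sup>2 / 2"
    using assms by (simp add: inverse_joukowski_inv norm_divide norm_power p_def q_def)
  ultimately have *: "cmod (joukowski_inv z) < inverse (cmod (joukowski_inv z))"
    by (simp add: norm_inverse)
  show ?thesis
  proof (rule ccontr)
    assume "\<not> cmod (joukowski_inv z) < 1"
    then have "inverse (cmod (joukowski_inv z)) \<le> 1"
      by (intro inverse_le_1_iff[THEN iffD2]) simp
    with * \<open>\<not> _\<close> show False by linarith
  qed
qed

text \<open>Imaginary parts in \<open>w + 1 / w = 2 z\<close> give
  \<open>Im w * (1 - 1 / (cmod w)\<^sup>2) = 2 * Im z\<close>, and the bracket is negative.\<close>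

lemma Im_joukowski_inv_neg:
  assumes "Im z > 0"
  shows "Im (joukowski_inv z) < 0"
proof -
  define w where "w = joukowski_inv z"
  have w: "w \<noteq> 0" "cmod w < 1"
    using assms joukowski_inv_nonzero[of z] cmod_joukowski_inv_less_1[of z] by (auto simp: w_def)
  then have n: "0 < (cmod w)\<^sup>2" "(cmod w)\<^sup>2 < 1"
    by (simp_all add: abs_square_less_1)
  have "Im w - Im w / (cmod w)\<^sup>2 = 2 * Im z"
    using arg_cong[OF joukowski_inv_add_inverse[of z], of Im] assms
    by (simp add: w_def cmod_power2)
  then have "Im w * ((cmod w)\<^sup>2 - 1) = 2 * Im z * (cmod w)\<^sup>2"
    using n by (simp add: field_simps)
  also have "\<dots> > 0" using n assms by simp
  finally show ?thesis
    using n by (simp add: w_def zero_less_mult_iff)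
qed

lemma joukowski_inv_of_real:
  assumes "x \<ge> 1"
  shows "joukowski_inv (of_real x) = of_real (x - sqrt (x\<^sup>2 - 1))"
proof -
  have "joukowski_inv (of_real x) = (of_real (sqrt (x + 1)) - of_real (sqrt (x - 1)))\<^sup>2 / 2"
    using assms usqrt_of_real(1)[of "x + 1"] usqrt_of_real(1)[of "x - 1"]
    by (simp add: joukowski_inv_def)
  also have "\<dots> = of_real ((sqrt (x + 1) - sqrt (x - 1))\<^sup>2 / 2)" by simp
  also have "(sqrt (x + 1) - sqrt (x - 1))\<^sup>2 / 2 = x - sqrt ((x + 1) * (x - 1))"
    using assms by (simp add: power2_diff real_sqrt_mult)
  also have "(x + 1) * (x - 1) = x\<^sup>2 - 1" by (simp add: algebra_simps power2_eq_square)
  finally show ?thesis .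
qed

text \<open>Approached from above, the cut goes to the lower unit semicircle: for
  \<open>x = cos t\<close> with t between 0 and pi the value is \<open>cis (- t)\<close>.\<close>

lemma joukowski_inv_of_real_cut:
  assumes "\<bar>x\<bar> \<le> 1"
  shows "joukowski_inv (of_real x) = Complex x (- sqrt (1 - x\<^sup>2))"
proof -
  have "joukowski_inv (of_real x) = (of_real (sqrt (1 + x)) - \<i> * of_real (sqrt (1 - x)))\<^sup>2 / 2"
    using assms usqrt_of_real(1)[of "x + 1"] usqrt_of_real(2)[of "x - 1"]
    by (simp add: joukowski_inv_def add.commute)
  also have "\<dots> = Complex x (- sqrt ((1 + x) * (1 - x)))"
    using assms by (intro complex_eqI) (simp_all add: power2_eq_square real_sqrt_mult)
  also have "(1 + x) * (1 - x) = 1 - x\<^sup>2" by (simp add: algebra_simps power2_eq_square)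
  finally show ?thesis .
qed

section \<open>Reflection in the imaginary axis and behaviour at infinity\<close>

lemma usqrt_neg_cnj_plus: "usqrt (- cnj z) = \<i> * cnj (usqrt z)"
  by (simp add: usqrt_def complex_eq_iff)

text \<open>The reflection exchanges the roles of \<open>z + 1\<close> and \<open>z - 1\<close>, and
  the common factor \<i> of the two roots squares to the minus sign. As the upper half plane is
  preserved, this is the source of oddness.\<close>

lemma joukowski_inv_neg_cnj: "joukowski_inv (- cnj z) = - cnj (joukowski_inv z)"
proof -
  have "usqrt (- cnj z + 1) = \<i> * cnj (usqrt (z - 1))" "usqrt (- cnj z - 1) = \<i> * cnj (usqrt (z + 1))"
    using usqrt_neg_cnj_plus[of "z - 1"] usqrt_neg_cnj_plus[of "z + 1"] by simp_all
  then show ?thesis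
    by (simp add: joukowski_inv_def power2_eq_square field_simps)
qed

text \<open>From \<open>2 z = w + 1 / w\<close> and \<open>cmod w < 1\<close> the modulus of
  \<open>1 / w\<close> is at least \<open>2 * cmod z - 1\<close>.\<close>

lemma joukowski_inv_tendsto_0:
  "(joukowski_inv \<longlongrightarrow> 0) (inf at_infinity (principal {z. Im z > 0}))"
proof (rule Lim_null_comparison)
  have lim: "filterlim (\<lambda>z. - 1 + 2 * cmod z) at_top at_infinity"
    by (intro filterlim_tendsto_add_at_top[OF tendsto_const]
        filterlim_tendsto_pos_mult_at_top[OF tendsto_const] filterlim_norm_at_top) simp
  show "((\<lambda>z. inverse (- 1 + 2 * cmod z)) \<longlongrightarrow> 0) (inf at_infinity (principal {z. Im z > 0}))"
    by (rule tendsto_mono[OF inf_le1]) (intro tendsto_inverse_0_at_top lim)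
  have "cmod (joukowski_inv z) \<le> inverse (- 1 + 2 * cmod z)" if "Im z > 0" "- 1 + 2 * cmod z > 0" for z
  proof -
    let ?w = "joukowski_inv z"
    have "2 * cmod z = cmod (?w + inverse ?w)"
      using that joukowski_inv_add_inverse[of z] by (simp add: norm_mult)
    also have "\<dots> \<le> cmod ?w + inverse (cmod ?w)"
      using norm_triangle_ineq[of ?w "inverse ?w"] by (simp add: norm_inverse)
    finally have "- 1 + 2 * cmod z \<le> inverse (cmod ?w)"
      using cmod_joukowski_inv_less_1[OF that(1)] by simp
    from le_imp_inverse_le[OF this that(2)] show ?thesis by simp
  qed
  then show "\<forall>\<^sub>F z in inf at_infinity (principal {z. Im z > 0}).
      norm (joukowski_inv z) \<le> inverse (- 1 + 2 * cmod z)"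
    unfolding eventually_inf_principal
    using filterlim_at_top_dense[THEN iffD1, OF lim, rule_format, of 0]
    by (auto elim!: eventually_mono)
qed

section \<open>The perturbation determinant\<close>

lemma cinner_scaleC_left: "cinner (scaleC c x) y = c * cinner x y"
  unfolding cinner_def using suminf_mult[OF cinner_summable[of x y], of c]
  by (simp add: mult.assoc)

lemma cinner_scaleC_right: "cinner x (scaleC c y) = cnj c * cinner x y"
  unfolding cinner_def using suminf_mult[OF cinner_summable[of x y], of "cnj c"]
  by (simp add: algebra_simps)

lemma Hop_diff: "Hop a (x - y) = Hop a x - Hop a y"
  by (rule ell2_eqI) (auto simp: coord_Hop algebra_simps)

lemma Hop_eigenvector_zero:
  assumes "Hop a w = scaleC z w" "Im z \<noteq> 0"
  shows "w = 0"
proof -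
  have "z * cinner w w = cnj z * cinner w w"
    using Hop_self_adjoint[of a w w] assms(1) by (simp add: cinner_scaleC_left cinner_scaleC_right)
  then have "cinner w w = 0"
    using assms(2) by (auto simp: complex_eq_iff)
  then have "inner w w = 0" by (simp add: inner_ell2_def)
  then show ?thesis by simp
qed

lemma inj_Hop_minus_scaleC:
  assumes "Im z \<noteq> 0"
  shows "inj (\<lambda>x. Hop a x - scaleC z x)"
proof (rule injI)
  fix x y assume "Hop a x - scaleC z x = Hop a y - scaleC z y"
  then have "Hop a x - Hop a y = scaleC z x - scaleC z y" by (simp add: algebra_simps)
  also have "\<dots> = scaleC z (x - y)" by (rule ell2_eqI) (simp add: algebra_simps)
  finally show "x = y"
    using Hop_eigenvector_zero[OF _ assms, of a "x - y"] by (simp add: Hop_diff)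
qed

text \<open>\<open>Rop\<close> is an \<open>inv_into\<close>, so an explicit preimage evaluates it
  as soon as the map is injective. The determinant is read off from two such values, at
  \<open>ebasis 0\<close> and \<open>ebasis 1\<close>.\<close>

lemma Rop_eqI:
  assumes "Im z \<noteq> 0" "Hop 1 x - scaleC z x = y"
  shows "Rop z y = x"
  unfolding Rop_def using assms by (intro inv_into_f_eq inj_Hop_minus_scaleC) auto

text \<open>The zero sequence is a default value that keeps the lifted function square summable for
  every \<open>w\<close>.\<close>

lift_definition geometric :: "complex \<Rightarrow> ell2"
  is "\<lambda>w n. if cmod w < 1 then w ^ n else 0"
proof -
  fix w :: complex
  show "summable (\<lambda>n. (cmod (if cmod w < 1 then w ^ n else 0))\<^sup>2)"
  proof (cases "cmod w < 1")
    case True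
    then have "summable (\<lambda>n. ((cmod w)\<^sup>2) ^ n)"
      by (intro summable_geometric) (simp add: power_less_one_iff abs_square_less_1)
    with True show ?thesis by (simp add: norm_power flip: power_mult) (simp add: mult.commute)
  qed simp
qed

text \<open>At every index \<open>n \<ge> 1\<close> the equation is the recurrence
  \<open>w ^ (n - 1) + w ^ (n + 1) = 2 * z * w ^ n\<close>, a multiple of the quadratic. At index 0
  the left neighbour is missing and \<open>w / 2 - z = - 1 / (2 * w)\<close> remains, whence the
  normalisation \<open>- 2 * w\<close>.\<close>

lemma Hop_minus_scaleC_geometric:
  assumes "cmod w < 1" "w\<^sup>2 + 1 = 2 * z * w"
  defines "u \<equiv> scaleC (- 2 * w) (geometric w)"
  shows "Hop 1 u - scaleC z u = ebasis 0"
proof (rule ell2_eqI)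
  have c: "coord u n = - 2 * w * w ^ n" for n
    unfolding u_def scaleC.rep_eq geometric.rep_eq using assms(1) by simp
  fix n :: nat
  consider "n = 0" | "n = 1" | m where "n = m + 2"
    using less_2_cases[of n] le_add_diff_inverse2[of 2 n] by (metis One_nat_def not_less)
  then show "coord (Hop 1 u - scaleC z u) n = coord (ebasis 0) n"
  proof cases
    case 1
    have "- (w * w) - z * (- 2 * w) = 2 * z * w - w\<^sup>2"
      by (simp add: power2_eq_square)
    then have "- (w * w) - z * (- 2 * w) = 1"
      unfolding assms(2)[symmetric] by simp
    with 1 show ?thesis by (simp add: coord_Hop c)
  next
    case 2
    have "(- 2 * w - 2 * w * w\<^sup>2) / 2 - z * (- 2 * w * w) = - w * (w\<^sup>2 + 1 - 2 * z * w)"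
      by (simp add: field_simps power2_eq_square)
    with 2 assms(2) show ?thesis by (simp add: coord_Hop c)
  next
    case 3
    have "(- 2 * w * w ^ Suc m - 2 * w * w ^ (m + 3)) / 2 - z * (- 2 * w * w ^ (m + 2))
        = - (w * w * w ^ m) * (w\<^sup>2 + 1 - 2 * z * w)"
      by (simp add: field_simps power2_eq_square power3_eq_cube power_add)
    with 3 assms(2) show ?thesis by (simp add: coord_Hop c numeral_3_eq_3)
  qed
qed

lemma Rop_ebasis_0:
  assumes "Im z > 0"
  shows "Rop z (ebasis 0) = scaleC (- 2 * joukowski_inv z) (geometric (joukowski_inv z))"
  using assms
  by (intro Rop_eqI Hop_minus_scaleC_geometric cmod_joukowski_inv_less_1 joukowski_inv_quadratic) auto

text \<open>Since \<open>H\<^sub>1 e\<^sub>0 = e\<^sub>1 / 2\<close>, one has \<open>R e\<^sub>1 = 2 R H\<^sub>1 e\<^sub>0 = 2 (e\<^sub>0 + z R e\<^sub>0)\<close>.\<close>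

lemma Rop_ebasis_1:
  assumes "Im z > 0"
  shows "Rop z (ebasis 1) = scaleC 2 (ebasis 0 + scaleC z (Rop z (ebasis 0)))"
proof (rule Rop_eqI)
  let ?u = "Rop z (ebasis 0)"
  have "Hop 1 ?u - scaleC z ?u = ebasis 0"
    unfolding Rop_ebasis_0[OF assms]
    using assms by (intro Hop_minus_scaleC_geometric cmod_joukowski_inv_less_1 joukowski_inv_quadratic) auto
  then have u: "Hop 1 ?u = ebasis 0 + scaleC z ?u" by (simp add: diff_eq_eq)
  show "Hop 1 (scaleC 2 (ebasis 0 + scaleC z ?u)) - scaleC z (scaleC 2 (ebasis 0 + scaleC z ?u)) = ebasis 1"
    unfolding Hop_scaleC Hop_add u
    by (rule ell2_eqI) (simp add: Hop_ebasis algebra_simps)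
qed (use assms in simp)

text \<open>The perturbation has its range in the span of \<open>ebasis 0\<close> and
  \<open>ebasis 1\<close>, so \<open>Det_finite_rank\<close> applies with sections of size
  2.\<close>

lemma coord_Vop:
  "coord (Vop a x) n = (if n = 0 then of_real ((a - 1) / 2) * coord x 1
     else if n = 1 then of_real ((a - 1) / 2) * coord x 0 else 0)"
  by (simp add: Vop_def coord_Hop algebra_simps diff_divide_distrib)

lemma det_2x2:
  assumes "A \<in> carrier_mat 2 2"
  shows "det A = A $$ (0, 0) * A $$ (1, 1) - A $$ (0, 1) * A $$ (1, 0)"
proof -
  have "det A = (\<Sum>j<2. A $$ (0, j) * cofactor A 0 j)"
    by (rule laplace_expansion_row[OF assms]) simp
  also have "\<dots> = A $$ (0, 0) * A $$ (1, 1) - A $$ (0, 1) * A $$ (1, 0)"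
    using assms by (simp add: numeral_2_eq_2 cofactor_def det_single mat_delete_def)
  finally show ?thesis .
qed

text \<open>With \<open>b = a - 1\<close> the two by two determinant is \<open>(1 - b
  w\<^sup>2)\<^sup>2 - b\<^sup>2 w\<^sup>2 (w\<^sup>2 + 1)\<close>. The fourth powers cancel,
  leaving the coefficient \<open>2 b + b\<^sup>2 = a\<^sup>2 - 1\<close> of
  \<open>- w\<^sup>2\<close>.\<close>

lemma Dpert_eq:
  assumes "Im z > 0"
  shows "Dpert a z = 1 - of_real (a\<^sup>2 - 1) * (joukowski_inv z)\<^sup>2"
proof -
  define w where "w = joukowski_inv z"
  have w: "cmod w < 1" "w\<^sup>2 + 1 = 2 * z * w"
    using assms by (simp_all add: w_def cmod_joukowski_inv_less_1 joukowski_inv_quadratic)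
  let ?B = "\<lambda>x. x + Vop a (Rop z x)"
  have "coord (Rop z (ebasis 0)) n = - 2 * w * w ^ n" for n
    using w(1) by (simp add: Rop_ebasis_0[OF assms] geometric.rep_eq flip: w_def)
  then have R0: "coord (Rop z (ebasis 0)) 0 = - 2 * w" "coord (Rop z (ebasis 0)) 1 = - 2 * w\<^sup>2"
    by (simp_all add: power2_eq_square)
  \<comment> \<open>Both coordinates are arranged so that \<open>2 * z * w\<close> occurs as a
    subterm; replacing it by \<open>w\<^sup>2 + 1\<close> eliminates \<open>z\<close>.\<close>
  have "2 * (1 + z * (- 2 * w)) = 2 - 2 * (2 * z * w)"
    "2 * (z * (- 2 * w\<^sup>2)) = - 2 * w * (2 * z * w)"
    by (simp_all add: algebra_simps power2_eq_square)
  then have "2 * (1 + z * (- 2 * w)) = - 2 * w\<^sup>2" "2 * (z * (- 2 * w\<^sup>2)) = - 2 * w * (w\<^sup>2 + 1)"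
    unfolding w(2)[symmetric] by simp_all
  then have R1: "coord (Rop z (ebasis 1)) 0 = - 2 * w\<^sup>2" "coord (Rop z (ebasis 1)) 1 = - 2 * w * (w\<^sup>2 + 1)"
    unfolding Rop_ebasis_1[OF assms] scaleC.rep_eq plus_ell2.rep_eq R0 by simp_all
  have "Dpert a z = det (section_mat ?B 2)"
    unfolding Dpert_def by (rule Det_finite_rank) (simp add: coord_Vop)
  also have "\<dots> = section_mat ?B 2 $$ (0, 0) * section_mat ?B 2 $$ (1, 1)
      - section_mat ?B 2 $$ (0, 1) * section_mat ?B 2 $$ (1, 0)"
    by (rule det_2x2) (simp add: section_mat_def)
  also have "\<dots> = (1 - (of_real a - 1) * w\<^sup>2)\<^sup>2 - (of_real a - 1) * w * (w\<^sup>2 + 1) * ((of_real a - 1) * w)"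
    by (simp add: section_mat_def cinner_ebasis coord_Vop R0[simplified] R1[simplified] power2_eq_square)
  also have "\<dots> = 1 - of_real (a\<^sup>2 - 1) * w\<^sup>2"
    by (simp add: power2_eq_square algebra_simps)
  finally show ?thesis by (simp add: w_def)
qed

section \<open>The argument of the determinant\<close>

lemma connected_upper_half_plane: "connected {z. Im z > 0}"
  by (intro convex_connected convex_halfspace_Im_gt)

lemma upper_half_plane_at_infinity_neq_bot: "inf at_infinity (principal {z. Im z > 0}) \<noteq> bot"
proof -
  have "\<exists>z. b \<le> cmod z \<and> Im z > 0" for b
    by (rule exI[of _ "Complex 0 (\<bar>b\<bar> + 1)"]) (simp add: complex_norm, arith)
  then show ?thesis
    unfolding trivial_limit_def eventually_inf_principal eventually_at_infinity by auto
qed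

text \<open>The difference of the two branches is continuous with values in the integer multiples of
  \<open>2 * pi\<close>, hence constant on a connected set. The common limit along a proper filter
  makes the constant zero.\<close>

lemma cis_branches_equal:
  fixes f g :: "'a::topological_space \<Rightarrow> real"
  assumes "connected S" "continuous_on S f" "continuous_on S g"
    and "\<And>z. z \<in> S \<Longrightarrow> cis (f z) = cis (g z)"
    and "inf F (principal S) \<noteq> bot"
    and "(f \<longlongrightarrow> l) (inf F (principal S))" "(g \<longlongrightarrow> l) (inf F (principal S))"
    and "z \<in> S"
  shows "f z = g z"
proof -
  define h where "h z = f z - g z" for z
  have period: "\<exists>n::int. h z = n * (2 * pi)" if "z \<in> S" for z
  proof -
    have "cis (h z) = 1"
      using assms(4)[OF that] by (simp add: h_def flip: cis_divide)
    then have "cos (h z) = 1" by (simp add: complex_eq_iff)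
    then show ?thesis by (auto simp: cos_one_2pi_int mult.assoc)
  qed
  have "h constant_on S"
  proof (rule continuous_discrete_range_constant[OF assms(1)])
    show "continuous_on S h"
      unfolding h_def by (intro continuous_intros assms)
    fix x assume "x \<in> S"
    then obtain n :: int where n: "h x = n * (2 * pi)" using period by blast
    have "2 * pi \<le> norm (h y - h x)" if y: "y \<in> S" "h y \<noteq> h x" for y
    proof -
      obtain m :: int where m: "h y = m * (2 * pi)" using period[OF y(1)] by blast
      then have "m \<noteq> n" using y n by auto
      then have "1 \<le> \<bar>real_of_int (m - n)\<bar>" by linarith
      then have "1 * (2 * pi) \<le> \<bar>real_of_int (m - n)\<bar> * (2 * pi)"
        by (intro mult_right_mono) auto
      also have "\<dots> = norm (h y - h x)"
        unfolding m n by (simp add: abs_mult flip: left_diff_distrib)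
      finally show ?thesis by simp
    qed
    then show "\<exists>e>0. \<forall>y. y \<in> S \<and> h y \<noteq> h x \<longrightarrow> e \<le> norm (h y - h x)"
      by (intro exI[of _ "2 * pi"]) auto
  qed
  then obtain c where c: "\<And>z. z \<in> S \<Longrightarrow> h z = c" by (auto simp: constant_on_def)
  have "(h \<longlongrightarrow> l - l) (inf F (principal S))"
    unfolding h_def by (intro tendsto_diff assms)
  moreover have "(h \<longlongrightarrow> c) (inf F (principal S))"
    by (rule tendsto_eventually) (simp add: eventually_inf_principal c)
  ultimately have "c = 0"
    using tendsto_unique[OF assms(5)] by fastforce
  with c[OF \<open>z \<in> S\<close>] show ?thesis by (simp add: h_def)
qed

text \<open>An explicit branch does two things: it witnesses the \<open>SOME\<close> in
  \<open>argD\<close>, so that \<open>argD\<close> has the three defining properties, and by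
  uniqueness it then agrees with \<open>argD\<close>. Nonvanishing of the determinant allows the
  modulus to be cancelled.\<close>

lemma argD_eqI:
  assumes "continuous_on {z. Im z > 0} \<theta>"
    and "\<And>z. Im z > 0 \<Longrightarrow> Dpert a z = of_real (cmod (Dpert a z)) * cis (\<theta> z)"
    and "\<And>z. Im z > 0 \<Longrightarrow> Dpert a z \<noteq> 0"
    and "(\<theta> \<longlongrightarrow> 0) (inf at_infinity (principal {z. Im z > 0}))"
    and "Im z > 0"
  shows "argD a z = \<theta> z"
proof -
  let ?P = "\<lambda>\<theta>. continuous_on {z. Im z > 0} \<theta> \<and>
      (\<forall>z. Im z > 0 \<longrightarrow> Dpert a z = of_real (cmod (Dpert a z)) * cis (\<theta> z)) \<and>
      (\<theta> \<longlongrightarrow> 0) (inf at_infinity (principal {z. Im z > 0}))"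
  have "?P (argD a)"
    unfolding argD_def by (rule someI[of ?P \<theta>]) (use assms in blast)
  then have argD: "continuous_on {z. Im z > 0} (argD a)"
    "\<And>z. Im z > 0 \<Longrightarrow> Dpert a z = of_real (cmod (Dpert a z)) * cis (argD a z)"
    "(argD a \<longlongrightarrow> 0) (inf at_infinity (principal {z. Im z > 0}))"
    by blast+
  have "cis (argD a z) = cis (\<theta> z)" if "Im z > 0" for z
  proof -
    have "of_real (cmod (Dpert a z)) * cis (argD a z) = of_real (cmod (Dpert a z)) * cis (\<theta> z)"
      using argD(2)[OF that] assms(2)[OF that] by simp
    then show ?thesis using assms(3)[OF that] by simp
  qed
  then show ?thesis
    using assms(5)
    by (intro cis_branches_equal[OF connected_upper_half_plane argD(1) assms(1) _
          upper_half_plane_at_infinity_neq_bot argD(3) assms(4)]) auto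
qed

lemma continuous_on_Arg_Re_pos:
  assumes "continuous_on S f" "\<And>z. z \<in> S \<Longrightarrow> Re (f z) > 0"
  shows "continuous_on S (\<lambda>z. Arg (f z))"
  using assms(2) by (intro continuous_on_Arg' assms(1)) (force simp: complex_nonpos_Reals_iff)

lemma polar_Arg: "of_real (cmod z) * cis (Arg z) = z"
  using rcis_cmod_Arg[of z] by (simp add: rcis_def)

lemma Arg_cnj_Re_pos: "Re z > 0 \<Longrightarrow> Arg (cnj z) = - Arg z"
  by (simp add: arg_conv_arctan arctan_minus)

lemma cmod_power2_joukowski_inv_less_1: "Im z > 0 \<Longrightarrow> cmod ((joukowski_inv z)\<^sup>2) < 1"
  using cmod_joukowski_inv_less_1[of z] by (simp add: norm_power abs_square_less_1)

text \<open>The term subtracted from 1 has modulus below 1, because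
  \<open>cmod w < 1\<close>.\<close>

lemma Re_Dpert_pos:
  assumes "\<bar>a\<^sup>2 - 1\<bar> \<le> 1" "Im z > 0"
  shows "Re (Dpert a z) > 0"
proof -
  let ?v = "of_real (a\<^sup>2 - 1) * (joukowski_inv z)\<^sup>2"
  have "Re ?v \<le> cmod ?v" by (rule complex_Re_le_cmod)
  also have "\<dots> = \<bar>a\<^sup>2 - 1\<bar> * cmod ((joukowski_inv z)\<^sup>2)"
    by (simp only: norm_mult norm_of_real)
  also have "\<dots> \<le> 1 * cmod ((joukowski_inv z)\<^sup>2)"
    using assms(1) by (intro mult_right_mono) auto
  also have "\<dots> < 1" using cmod_power2_joukowski_inv_less_1[OF assms(2)] by simp
  finally show ?thesis unfolding Dpert_eq[OF assms(2)] by simp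
qed

lemma argD_small:
  assumes "\<bar>a\<^sup>2 - 1\<bar> \<le> 1" "Im z > 0"
  shows "argD a z = Arg (1 - of_real (a\<^sup>2 - 1) * (joukowski_inv z)\<^sup>2)"
proof (rule argD_eqI[OF _ _ _ _ assms(2)])
  let ?D = "\<lambda>z. 1 - of_real (a\<^sup>2 - 1) * (joukowski_inv z)\<^sup>2"
  have pos: "Re (?D z) > 0" if "Im z > 0" for z
    using Re_Dpert_pos[OF assms(1) that] by (simp only: Dpert_eq[OF that])
  show "continuous_on {z. 0 < Im z} (\<lambda>z. Arg (?D z))"
    by (intro continuous_on_Arg_Re_pos continuous_intros) (use pos in blast)
  show "Dpert a z = of_real (cmod (Dpert a z)) * cis (Arg (?D z))" if "Im z > 0" for z
    unfolding Dpert_eq[OF that] polar_Arg by (rule refl)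
  show "Dpert a z \<noteq> 0" if "Im z > 0" for z
    using Re_Dpert_pos[OF assms(1) that] by auto
  have "((\<lambda>z. Arg (?D z)) \<longlongrightarrow> Arg (1 - of_real (a\<^sup>2 - 1) * 0\<^sup>2)) (inf at_infinity (principal {z. Im z > 0}))"
    by (intro tendsto_intros joukowski_inv_tendsto_0) simp
  then show "((\<lambda>z. Arg (?D z)) \<longlongrightarrow> 0) (inf at_infinity (principal {z. Im z > 0}))"
    by simp
qed

text \<open>For \<open>a\<^sup>2 > 1\<close> the determinant factorises as \<open>(1 - s w) (1 + s w)\<close> with \<open>s\<^sup>2 = a\<^sup>2 - 1\<close>. As
  \<open>Im w < 0\<close>, multiplying the factors by \<open>-\<i>\<close> and \<open>\<i>\<close> moves both into the right half plane.\<close>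

lemma argD_large:
  assumes "a\<^sup>2 > 1" "Im z > 0"
  shows "argD a z = Arg (- \<i> * (1 - of_real (sqrt (a\<^sup>2 - 1)) * joukowski_inv z))
    + Arg (\<i> * (1 + of_real (sqrt (a\<^sup>2 - 1)) * joukowski_inv z))"
proof (rule argD_eqI[OF _ _ _ _ assms(2)])
  define s where "s = sqrt (a\<^sup>2 - 1)"
  have s: "s > 0" "a\<^sup>2 - 1 = s * s" using assms by (simp_all add: s_def)
  let ?p = "\<lambda>z. - \<i> * (1 - of_real s * joukowski_inv z)" and ?q = "\<lambda>z. \<i> * (1 + of_real s * joukowski_inv z)"
  have pos: "Re (?p z) > 0" "Re (?q z) > 0" if "Im z > 0" for z
    using mult_pos_neg[OF s(1) Im_joukowski_inv_neg[OF that]] by simp_all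
  have D: "Dpert a z = ?p z * ?q z" if "Im z > 0" for z
    unfolding Dpert_eq[OF that] s(2) by (simp add: algebra_simps power2_eq_square)
  show "continuous_on {z. 0 < Im z} (\<lambda>z. Arg (?p z) + Arg (?q z))"
    by (intro continuous_on_add continuous_on_Arg_Re_pos continuous_intros) (use pos in blast)+
  show "Dpert a z = of_real (cmod (Dpert a z)) * cis (Arg (?p z) + Arg (?q z))" if "Im z > 0" for z
  proof -
    have "of_real (cmod (?p z * ?q z)) * cis (Arg (?p z) + Arg (?q z))
      = (of_real (cmod (?p z)) * cis (Arg (?p z))) * (of_real (cmod (?q z)) * cis (Arg (?q z)))"
      unfolding norm_mult of_real_mult cis_mult[symmetric] by (simp only: ac_simps)
    then show ?thesis unfolding polar_Arg D[OF that] by simp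
  qed
  show "Dpert a z \<noteq> 0" if "Im z > 0" for z
    using pos[OF that] D[OF that] by (metis less_irrefl mult_eq_0_iff zero_complex.simps(1))
  \<comment> \<open>At infinity the two rotated factors tend to \<open>- \<i>\<close> and \<i>,
    whose arguments \<open>- pi / 2\<close> and \<open>pi / 2\<close> cancel; this is the required
    normalisation.\<close>
  have "((\<lambda>z. Arg (?p z) + Arg (?q z)) \<longlongrightarrow> Arg (- \<i> * (1 - of_real s * 0)) + Arg (\<i> * (1 + of_real s * 0)))
      (inf at_infinity (principal {z. Im z > 0}))"
    by (intro tendsto_intros joukowski_inv_tendsto_0) (simp_all add: complex_nonpos_Reals_iff)
  then show "((\<lambda>z. Arg (?p z) + Arg (?q z)) \<longlongrightarrow> 0) (inf at_infinity (principal {z. Im z > 0}))"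
    by simp
qed

text \<open>Reflection turns \<open>w\<close> into \<open>- cnj w\<close>, so
  \<open>w\<^sup>2\<close> and with it the determinant are conjugated. In the factorised form each
  rotated factor becomes the conjugate of the other one.\<close>

lemma argD_neg_cnj:
  assumes "a \<noteq> 0" "Im z > 0"
  shows "argD a (- cnj z) = - argD a z"
proof -
  have z: "Im (- cnj z) > 0" using assms by simp
  show ?thesis
  proof (cases "\<bar>a\<^sup>2 - 1\<bar> \<le> 1")
    case True
    let ?D = "1 - of_real (a\<^sup>2 - 1) * (joukowski_inv z)\<^sup>2"
    have "argD a (- cnj z) = Arg (cnj ?D)"
      unfolding argD_small[OF True z] joukowski_inv_neg_cnj by simp
    also have "\<dots> = - Arg ?D"
      using Re_Dpert_pos[OF True assms(2)] unfolding Dpert_eq[OF assms(2)] by (rule Arg_cnj_Re_pos)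
    finally show ?thesis unfolding argD_small[OF True assms(2)] .
  next
    case False
    have a: "a\<^sup>2 > 1"
      using False assms(1) zero_less_power2[of a] by (auto simp: abs_if split: if_splits)
    define s where "s = sqrt (a\<^sup>2 - 1)"
    let ?p = "- \<i> * (1 - of_real s * joukowski_inv z)" and ?q = "\<i> * (1 + of_real s * joukowski_inv z)"
    have s: "s > 0" using a by (simp add: s_def)
    have pos: "Re ?p > 0" "Re ?q > 0"
      using mult_pos_neg[OF s Im_joukowski_inv_neg[OF assms(2)]] by simp_all
    have "argD a (- cnj z) = Arg (cnj ?q) + Arg (cnj ?p)"
      unfolding argD_large[OF a z] joukowski_inv_neg_cnj s_def by simp
    also have "\<dots> = - (Arg ?p + Arg ?q)"
      unfolding pos[THEN Arg_cnj_Re_pos] by simp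
    finally show ?thesis unfolding argD_large[OF a assms(2)] s_def .
  qed
qed

section \<open>Boundary values\<close>

text \<open>A relation rather than a value of \<open>Lim\<close>, so that existence of the limit is
  part of every statement about boundary values.\<close>

definition boundary_arg :: "real \<Rightarrow> real \<Rightarrow> real \<Rightarrow> bool"
  where "boundary_arg a x l \<longleftrightarrow> ((\<lambda>\<epsilon>. argD a (Complex x \<epsilon>)) \<longlongrightarrow> l) (at_right 0)"

lemma ssf_eqI: "boundary_arg a x l \<Longrightarrow> ssf a x = 1 / pi * l"
  unfolding boundary_arg_def ssf_def by (subst tendsto_Lim) auto

lemma boundary_argI:
  assumes "(\<theta> \<longlongrightarrow> l) (at_right 0)" "\<And>\<epsilon>. \<epsilon> > 0 \<Longrightarrow> argD a (Complex x \<epsilon>) = \<theta> \<epsilon>"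
  shows "boundary_arg a x l"
  unfolding boundary_arg_def
  by (rule Lim_transform_eventually[OF assms(1)])
    (use assms(2) in \<open>auto simp: eventually_at_right_less intro!: eventually_mono[OF eventually_at_right_less]\<close>)

lemma boundary_arg_minus:
  assumes "a \<noteq> 0" "boundary_arg a x l"
  shows "boundary_arg a (- x) (- l)"
proof (rule boundary_argI)
  show "((\<lambda>\<epsilon>. - argD a (Complex x \<epsilon>)) \<longlongrightarrow> - l) (at_right 0)"
    using assms(2) unfolding boundary_arg_def by (rule tendsto_minus)
  show "argD a (Complex (- x) \<epsilon>) = - argD a (Complex x \<epsilon>)" if "\<epsilon> > 0" for \<epsilon>
    using argD_neg_cnj[OF assms(1), of "Complex x \<epsilon>"] that by (simp add: complex_cnj complex_minus)
qed

lemma ssf_minus: "a \<noteq> 0 \<Longrightarrow> boundary_arg a x l \<Longrightarrow> ssf a (- x) = - ssf a x"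
  using ssf_eqI[OF boundary_arg_minus] ssf_eqI by force

lemma tendsto_boundary:
  assumes "continuous_on UNIV (f :: complex \<Rightarrow> complex)"
  shows "((\<lambda>\<epsilon>. f (Complex x \<epsilon>)) \<longlongrightarrow> f (of_real x)) (at_right 0)"
proof -
  have "continuous_on UNIV (\<lambda>\<epsilon>. f (Complex x \<epsilon>))"
    by (rule continuous_on_compose2[OF assms]) (auto intro!: continuous_intros)
  then have "((\<lambda>\<epsilon>. f (Complex x \<epsilon>)) \<longlongrightarrow> f (Complex x 0)) (at 0)"
    by (auto simp: continuous_on_def)
  then show ?thesis
    by (auto simp: complex_of_real_def intro: tendsto_within_subset)
qed

lemmas tendsto_joukowski_inv_boundary =
  tendsto_boundary[OF continuous_on_joukowski_inv[OF continuous_on_id]]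

lemma boundary_arg_small:
  assumes "\<bar>a\<^sup>2 - 1\<bar> \<le> 1"
    and "1 - of_real (a\<^sup>2 - 1) * (joukowski_inv (of_real x))\<^sup>2 \<notin> \<real>\<^sub>\<le>\<^sub>0"
  shows "boundary_arg a x (Arg (1 - of_real (a\<^sup>2 - 1) * (joukowski_inv (of_real x))\<^sup>2))"
proof (rule boundary_argI)
  let ?D = "\<lambda>\<epsilon>. 1 - of_real (a\<^sup>2 - 1) * (joukowski_inv (Complex x \<epsilon>))\<^sup>2"
  show "((\<lambda>\<epsilon>. Arg (?D \<epsilon>)) \<longlongrightarrow> Arg (1 - of_real (a\<^sup>2 - 1) * (joukowski_inv (of_real x))\<^sup>2)) (at_right 0)"
    by (intro tendsto_intros tendsto_joukowski_inv_boundary assms(2))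
  show "argD a (Complex x \<epsilon>) = Arg (?D \<epsilon>)" if "\<epsilon> > 0" for \<epsilon>
    using that by (intro argD_small assms(1)) simp
qed

lemma boundary_arg_large:
  assumes "a\<^sup>2 > 1"
    and "- \<i> * (1 - of_real (sqrt (a\<^sup>2 - 1)) * joukowski_inv (of_real x)) \<notin> \<real>\<^sub>\<le>\<^sub>0"
    and "\<i> * (1 + of_real (sqrt (a\<^sup>2 - 1)) * joukowski_inv (of_real x)) \<notin> \<real>\<^sub>\<le>\<^sub>0"
  shows "boundary_arg a x (Arg (- \<i> * (1 - of_real (sqrt (a\<^sup>2 - 1)) * joukowski_inv (of_real x)))
    + Arg (\<i> * (1 + of_real (sqrt (a\<^sup>2 - 1)) * joukowski_inv (of_real x))))"
proof (rule boundary_argI)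
  let ?p = "\<lambda>w. - \<i> * (1 - of_real (sqrt (a\<^sup>2 - 1)) * w)" and ?q = "\<lambda>w. \<i> * (1 + of_real (sqrt (a\<^sup>2 - 1)) * w)"
  let ?w = "\<lambda>\<epsilon>. joukowski_inv (Complex x \<epsilon>)"
  show "((\<lambda>\<epsilon>. Arg (?p (?w \<epsilon>)) + Arg (?q (?w \<epsilon>))) \<longlongrightarrow>
      Arg (?p (joukowski_inv (of_real x))) + Arg (?q (joukowski_inv (of_real x)))) (at_right 0)"
    by (intro tendsto_intros tendsto_joukowski_inv_boundary assms(2,3))
  show "argD a (Complex x \<epsilon>) = Arg (?p (?w \<epsilon>)) + Arg (?q (?w \<epsilon>))" if "\<epsilon> > 0" for \<epsilon>
    using that by (intro argD_large assms(1)) simp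
qed

lemma joukowski_inv_of_real_bounds:
  fixes x :: real
  assumes "x \<ge> 1"
  defines "r \<equiv> x - sqrt (x\<^sup>2 - 1)"
  shows "0 < r" "r \<le> 1" "x > 1 \<Longrightarrow> r < 1" "r\<^sup>2 + 1 = 2 * x * r"
proof -
  have x: "1 \<le> x\<^sup>2" using assms by simp
  have "sqrt (x\<^sup>2 - 1) < sqrt (x\<^sup>2)" by (rule real_sqrt_less_mono) simp
  then show "0 < r" using assms by simp
  show q: "r\<^sup>2 + 1 = 2 * x * r"
    using x by (simp add: r_def power2_diff algebra_simps power2_eq_square)
  have "(x - 1)\<^sup>2 \<le> x\<^sup>2 - 1" using assms(1) by (simp add: power2_eq_square algebra_simps)
  then have "x - 1 \<le> sqrt (x\<^sup>2 - 1)" by (rule real_le_rsqrt)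
  then show "r \<le> 1" by (simp add: r_def)
  moreover have "r \<noteq> 1" if "x > 1" using q that by auto
  ultimately show "r < 1" if "x > 1" using that by fastforce
qed

section \<open>Limits on the real axis for \<open>a\<^sup>2 \<le> 2\<close>\<close>

lemma boundary_arg_small_interior:
  assumes "a \<noteq> 0" "\<bar>a\<^sup>2 - 1\<bar> \<le> 1" "0 \<le> x" "x < 1"
  shows "boundary_arg a x
    (arctan (2 * (a\<^sup>2 - 1) * x * sqrt (1 - x\<^sup>2) / (1 + (1 - a\<^sup>2) * (2 * x\<^sup>2 - 1))))"
proof -
  have x: "x\<^sup>2 < 1" using assms by (simp add: abs_square_less_1)
  \<comment> \<open>On the cut
    \<open>w\<^sup>2 = 2 x\<^sup>2 - 1 - 2 \<i> x sqrt (1 - x\<^sup>2)\<close>, so numerator and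
    denominator of the claimed quotient are the imaginary and the real part of this limiting
    determinant.\<close>
  define D where "D = 1 - of_real (a\<^sup>2 - 1) * (joukowski_inv (of_real x))\<^sup>2"
  have D: "Re D = 1 + (1 - a\<^sup>2) * (2 * x\<^sup>2 - 1)" "Im D = 2 * (a\<^sup>2 - 1) * x * sqrt (1 - x\<^sup>2)"
    using assms x joukowski_inv_of_real_cut[of x]
    by (simp_all add: D_def power2_eq_square algebra_simps)
  have "(a\<^sup>2 - 1) * (2 * x\<^sup>2 - 1) < 1"
  proof (cases "a\<^sup>2 - 1 \<ge> 0")
    case True
    then have "(a\<^sup>2 - 1) * (2 * x\<^sup>2 - 1) \<le> (a\<^sup>2 - 1) * x\<^sup>2"
      using x by (intro mult_left_mono) auto
    also have "\<dots> \<le> 1 * x\<^sup>2" using assms by (intro mult_right_mono) auto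
    finally show ?thesis using x by simp
  next
    case False
    then have "(1 - a\<^sup>2) * (1 - 2 * x\<^sup>2) \<le> (1 - a\<^sup>2) * 1"
      by (intro mult_left_mono) auto
    also have "\<dots> < 1" using assms(1) by simp
    finally show ?thesis by (simp add: algebra_simps)
  qed
  then have pos: "Re D > 0" unfolding D by (simp add: algebra_simps)
  then have "D \<notin> \<real>\<^sub>\<le>\<^sub>0" by (simp add: complex_nonpos_Reals_iff)
  from boundary_arg_small[OF assms(2) this[unfolded D_def]] show ?thesis
    unfolding D_def[symmetric] arg_conv_arctan[OF pos] D .
qed

text \<open>Here \<open>w = r\<close> is real with \<open>0 < r \<le> 1\<close>, so the limiting
  determinant is the real number \<open>1 - (a\<^sup>2 - 1) * r\<^sup>2\<close>. It is positive
  except for \<open>r = 1\<close> and \<open>a\<^sup>2 = 2\<close>, the excluded case.\<close>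

lemma boundary_arg_small_exterior:
  assumes "\<bar>a\<^sup>2 - 1\<bar> \<le> 1" "x \<ge> 1" "a\<^sup>2 < 2 \<or> x > 1"
  shows "boundary_arg a x 0"
proof -
  define r where "r = x - sqrt (x\<^sup>2 - 1)"
  have r: "0 < r" "r \<le> 1" "x > 1 \<Longrightarrow> r < 1"
    using joukowski_inv_of_real_bounds[OF assms(2)] by (simp_all add: r_def)
  have "r\<^sup>2 \<le> 1" using r by (simp add: abs_square_le_1)
  have "(a\<^sup>2 - 1) * r\<^sup>2 < 1"
    using assms(3)
  proof
    assume "a\<^sup>2 < 2"
    show ?thesis
    proof (cases "a\<^sup>2 - 1 \<ge> 0")
      case True
      then have "(a\<^sup>2 - 1) * r\<^sup>2 \<le> (a\<^sup>2 - 1) * 1"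
        using \<open>r\<^sup>2 \<le> 1\<close> by (intro mult_left_mono) auto
      with \<open>a\<^sup>2 < 2\<close> show ?thesis by simp
    next
      case False
      then have "(a\<^sup>2 - 1) * r\<^sup>2 \<le> 0" by (intro mult_nonpos_nonneg) auto
      then show ?thesis by simp
    qed
  next
    assume "x > 1"
    then have "r\<^sup>2 < 1" using r by (simp add: abs_square_less_1)
    have "(a\<^sup>2 - 1) * r\<^sup>2 \<le> 1 * r\<^sup>2" using assms(1) by (intro mult_right_mono) auto
    with \<open>r\<^sup>2 < 1\<close> show ?thesis by simp
  qed
  moreover have D: "1 - of_real (a\<^sup>2 - 1) * (joukowski_inv (of_real x))\<^sup>2
      = (of_real (1 - (a\<^sup>2 - 1) * r\<^sup>2) :: complex)"
    using joukowski_inv_of_real[OF assms(2)] by (simp add: r_def)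
  ultimately have "1 - of_real (a\<^sup>2 - 1) * (joukowski_inv (of_real x))\<^sup>2 \<notin> \<real>\<^sub>\<le>\<^sub>0"
    "Arg (1 - of_real (a\<^sup>2 - 1) * (joukowski_inv (of_real x))\<^sup>2) = 0"
    unfolding D by (simp_all add: complex_nonpos_Reals_iff del: of_real_diff of_real_mult)
  with boundary_arg_small[OF assms(1)] show ?thesis by metis
qed

text \<open>At the threshold \<open>x = 1\<close> for \<open>a\<^sup>2 = 2\<close> the determinant \<open>1 - w\<^sup>2 = w (1 / w - w)\<close> vanishes in the
  limit; dividing by \<open>sqrt \<epsilon>\<close> leaves the argument unchanged and gives a nonzero limit.\<close>

lemma boundary_arg_threshold:
  assumes "a\<^sup>2 = 2"
  shows "\<exists>l. boundary_arg a 1 l"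
proof -
  \<comment> \<open>With p and q the two roots, \<open>1 / w - w = 2 p q\<close>, and at
    \<open>1 + \<i> \<epsilon>\<close> the root q is \<open>sqrt \<epsilon> * usqrt \<i>\<close>.
    Thus \<open>?f\<close> is the determinant divided by \<open>sqrt \<epsilon>\<close>.\<close>
  let ?f = "\<lambda>z. 2 * joukowski_inv z * usqrt (z + 1) * usqrt \<i>"
  have "continuous_on UNIV ?f" by (intro continuous_intros)
  from tendsto_boundary[OF this, of 1]
  have lim: "((\<lambda>\<epsilon>. ?f (Complex 1 \<epsilon>)) \<longlongrightarrow> ?f (of_real 1)) (at_right 0)" .
  have "?f (of_real 1) = of_real (2 * sqrt 2) * usqrt \<i>"
    using joukowski_inv_of_real[of 1] usqrt_of_real(1)[of 2] by simp
  moreover have "of_real (2 * sqrt 2) * usqrt \<i> \<notin> \<real>\<^sub>\<le>\<^sub>0"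
    by (simp add: complex_nonpos_Reals_iff usqrt_def)
  ultimately have "?f (of_real 1) \<notin> \<real>\<^sub>\<le>\<^sub>0" by (simp only: not_False_eq_True)
  from tendsto_Arg[OF lim this]
  have "((\<lambda>\<epsilon>. Arg (?f (Complex 1 \<epsilon>))) \<longlongrightarrow> Arg (?f (of_real 1))) (at_right 0)" .
  moreover have "argD a (Complex 1 \<epsilon>) = Arg (?f (Complex 1 \<epsilon>))" if "\<epsilon> > 0" for \<epsilon>
  proof -
    let ?z = "Complex 1 \<epsilon>"
    let ?w = "joukowski_inv ?z" and ?p = "usqrt (?z + 1)" and ?q = "usqrt (?z - 1)"
    have z: "Im ?z \<ge> 0" "Im ?z > 0" using that by simp_all
    have "?z - 1 = Complex 0 \<epsilon>" by (simp add: complex_eq_iff)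
    then have q: "?q = of_real (sqrt \<epsilon>) * usqrt \<i>"
      using usqrt_imaginary[of \<epsilon>] that by simp
    have "inverse ?w - ?w = 2 * ?p * ?q"
      unfolding inverse_joukowski_inv[OF z(1)] unfolding joukowski_inv_def
      by (simp add: power2_eq_square field_simps)
    then have "?w * (inverse ?w - ?w) = ?w * (2 * ?p * ?q)" by simp
    moreover have "?w * (inverse ?w - ?w) = 1 - ?w\<^sup>2"
      using joukowski_inv_nonzero[OF z(1)] by (simp add: power2_eq_square right_diff_distrib)
    ultimately have "1 - of_real (a\<^sup>2 - 1) * ?w\<^sup>2 = ?f ?z * of_real (sqrt \<epsilon>)"
      by (simp add: assms q mult_ac)
    then show ?thesis
      using argD_small[OF _ z(2), of a] that assms by simp
  qed
  ultimately show ?thesis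
    by (intro exI boundary_argI)
qed

section \<open>Limits on the real axis in the factorised case\<close>

lemma arccot_eqI:
  assumes "0 < x" "x < pi" "cot x = y"
  shows "arccot y = x"
proof -
  \<comment> \<open>Passing to \<open>pi / 2 - x'\<close> turns \<open>cot\<close> into
    \<open>tan\<close> on the interval where \<open>arctan\<close> inverts it.\<close>
  have "x' = pi / 2 - arctan y" if "0 < x' \<and> x' < pi \<and> cot x' = y" for x'
    using arctan_unique[of "pi / 2 - x'" y] that by (simp add: tan_cot')
  then show ?thesis
    unfolding arccot_def using assms by (intro the_equality) (blast, metis)
qed

lemma arccot_arctan: "arccot y = pi / 2 - arctan y"
  using arctan_bounded[of y] tan_cot'[of "pi / 2 - arctan y"]
  by (intro arccot_eqI) (auto simp: tan_arctan)

text \<open>The limit is a sum of two principal values of modulus below \<open>pi / 2\<close>, so it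
  lies strictly between \<open>- pi\<close> and \<open>pi\<close>. For \<open>x > 0\<close> the
  limiting determinant has positive imaginary part, which places the sum in the range of
  \<open>arccot\<close>, where the cotangent determines it. The real part may change sign, so
  \<open>arctan\<close> would not give one formula.\<close>

lemma boundary_arg_large_interior:
  assumes "a\<^sup>2 > 1" "0 \<le> x" "x < 1"
  shows "\<exists>l. boundary_arg a x l \<and>
    (x > 0 \<longrightarrow> l = arccot ((1 - (a\<^sup>2 - 1) * (2 * x\<^sup>2 - 1)) / (2 * (a\<^sup>2 - 1) * x * sqrt (1 - x\<^sup>2))))"
proof -
  define s t where "s = sqrt (a\<^sup>2 - 1)" and "t = sqrt (1 - x\<^sup>2)"
  have "x\<^sup>2 < 1" using assms by (simp add: abs_square_less_1)
  then have st: "s > 0" "t > 0" "s\<^sup>2 = a\<^sup>2 - 1" "t\<^sup>2 = 1 - x\<^sup>2"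
    using assms by (simp_all add: s_def t_def)
  let ?w = "joukowski_inv (of_real x)"
  define p q where "p = - \<i> * (1 - of_real s * ?w)" and "q = \<i> * (1 + of_real s * ?w)"
  have w: "?w = Complex x (- t)"
    using assms joukowski_inv_of_real_cut[of x] by (simp add: t_def)
  have Re: "Re p = s * t" "Re q = s * t" and Im: "Im p = s * x - 1" "Im q = s * x + 1"
    by (simp_all add: p_def q_def w)
  have pos: "Re p > 0" "Re q > 0" using st Re by simp_all
  then have "p \<notin> \<real>\<^sub>\<le>\<^sub>0" "q \<notin> \<real>\<^sub>\<le>\<^sub>0" by (simp_all add: complex_nonpos_Reals_iff)
  then have lim: "boundary_arg a x (Arg p + Arg q)"
    unfolding p_def q_def s_def by (intro boundary_arg_large assms(1))
  have "Arg p + Arg q = arccot ((1 - (a\<^sup>2 - 1) * (2 * x\<^sup>2 - 1)) / (2 * (a\<^sup>2 - 1) * x * sqrt (1 - x\<^sup>2)))"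
    if "x > 0"
  proof -
    define l where "l = Arg p + Arg q"
    define D where "D = p * q"
    have "D = (of_real (cmod p) * cis (Arg p)) * (of_real (cmod q) * cis (Arg q))"
      unfolding polar_Arg D_def by (rule refl)
    also have "\<dots> = of_real (cmod D) * cis l"
      unfolding D_def norm_mult of_real_mult l_def cis_mult[symmetric] by (simp only: ac_simps)
    finally have D: "D = of_real (cmod D) * cis l" .
    have polar: "Re D = cmod D * cos l" "Im D = cmod D * sin l"
      using arg_cong[OF D, of Re] arg_cong[OF D, of Im] by simp_all
    have "Re D = s\<^sup>2 * t\<^sup>2 - s\<^sup>2 * x\<^sup>2 + 1" "Im D = 2 * s\<^sup>2 * x * t"
      by (simp_all add: D_def Re Im power2_eq_square algebra_simps)
    then have RI: "Re D = 1 - (a\<^sup>2 - 1) * (2 * x\<^sup>2 - 1)" "Im D = 2 * (a\<^sup>2 - 1) * x * t"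
      unfolding st(3,4) by (simp_all add: algebra_simps)
    have n: "cmod D > 0" unfolding D_def using pos by auto
    have "\<bar>Arg p\<bar> < pi / 2" "\<bar>Arg q\<bar> < pi / 2" using pos Arg_Re_pos by blast+
    then have l: "- pi < l" "l < pi" unfolding l_def by linarith+
    have "Im D > 0" unfolding RI using that st assms(1) by simp
    then have "sin l > 0" unfolding polar using n by (simp add: zero_less_mult_iff)
    then have "l > 0"
      using l sin_ge_zero[of "- l"] by (cases "l > 0") auto
    have "cot l = Re D / Im D"
      unfolding polar cot_def using n by simp
    with \<open>l > 0\<close> l show ?thesis
      unfolding l_def[symmetric] RI t_def[symmetric] by (metis arccot_eqI)
  qed
  with lim show ?thesis by blast
qed

text \<open>With \<open>r + 1 / r = 2 x\<close> one has \<open>2 s (lambda_plus a - x) = (1 - s r) (1 - s / r)\<close>.\<close>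

lemma lambda_plus_cmp:
  assumes "a\<^sup>2 > 2" "x \<ge> 1"
  defines "s \<equiv> sqrt (a\<^sup>2 - 1)" and "r \<equiv> x - sqrt (x\<^sup>2 - 1)"
  shows "x < lambda_plus a \<longleftrightarrow> 1 < s * r" "x > lambda_plus a \<longleftrightarrow> s * r < 1"
proof -
  have r: "0 < r" "r \<le> 1" "r\<^sup>2 + 1 = 2 * x * r"
    using joukowski_inv_of_real_bounds[OF assms(2)] by (simp_all add: r_def)
  have s: "s > 1" "s\<^sup>2 = a\<^sup>2 - 1" using assms by (simp_all add: s_def)
  have "lambda_plus a = (s\<^sup>2 + 1) / (2 * s)"
    unfolding s by (simp add: lambda_plus_def s_def)
  then have "2 * s * r * (lambda_plus a - x) = r * (s\<^sup>2 + 1) - s * (2 * x * r)"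
    using s by (simp add: field_simps)
  also have "\<dots> = (s * r - 1) * (s - r)"
    unfolding r(3)[symmetric] by (simp add: power2_eq_square algebra_simps)
  finally have *: "2 * s * r * (lambda_plus a - x) = (s * r - 1) * (s - r)" .
  have sr: "s - r > 0" "2 * s * r > 0" using r s by simp_all
  have "0 < lambda_plus a - x \<longleftrightarrow> 0 < 2 * s * r * (lambda_plus a - x)"
    using mult_less_cancel_left_pos[OF sr(2), of 0 "lambda_plus a - x"] by simp
  also have "\<dots> \<longleftrightarrow> 0 < s * r - 1"
    unfolding * using mult_less_cancel_right_pos[OF sr(1), of 0 "s * r - 1"] by simp
  finally show "x < lambda_plus a \<longleftrightarrow> 1 < s * r" by simp
  have "lambda_plus a - x < 0 \<longleftrightarrow> 2 * s * r * (lambda_plus a - x) < 0"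
    using mult_less_cancel_left_pos[OF sr(2), of "lambda_plus a - x" 0] by simp
  also have "\<dots> \<longleftrightarrow> s * r - 1 < 0"
    unfolding * using mult_less_cancel_right_pos[OF sr(1), of "s * r - 1" 0] by simp
  finally show "x > lambda_plus a \<longleftrightarrow> s * r < 1" by simp
qed

lemma Arg_ii_mult_of_real:
  "t > 0 \<Longrightarrow> Arg (\<i> * of_real t) = pi / 2" "t < 0 \<Longrightarrow> Arg (\<i> * of_real t) = - pi / 2"
  using Arg_times_of_real2[of t \<i>] Arg_times_of_real2[of "- t" "- \<i>"] by simp_all

text \<open>For \<open>w = r\<close> both rotated factors are purely imaginary. The second
  contributes \<open>pi / 2\<close>; the first contributes \<open>pi / 2\<close> or
  \<open>- pi / 2\<close> according to the sign of \<open>s * r - 1\<close>, which changes at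
  \<open>lambda_plus a\<close>.\<close>

lemma boundary_arg_large_exterior:
  assumes "a\<^sup>2 > 2" "x \<ge> 1"
  shows "x < lambda_plus a \<Longrightarrow> boundary_arg a x pi" "x > lambda_plus a \<Longrightarrow> boundary_arg a x 0"
proof -
  define s r where "s = sqrt (a\<^sup>2 - 1)" and "r = x - sqrt (x\<^sup>2 - 1)"
  have s: "s > 0" and r: "r > 0"
    using assms joukowski_inv_of_real_bounds[OF assms(2)] by (simp_all add: s_def r_def)
  have eq: "- \<i> * (1 - of_real (sqrt (a\<^sup>2 - 1)) * joukowski_inv (of_real x)) = \<i> * of_real (s * r - 1)"
    "\<i> * (1 + of_real (sqrt (a\<^sup>2 - 1)) * joukowski_inv (of_real x)) = \<i> * of_real (1 + s * r)"
    unfolding joukowski_inv_of_real[OF assms(2)] s_def r_def by (simp_all add: algebra_simps)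
  have q: "Arg (\<i> * of_real (1 + s * r)) = pi / 2"
    using s r by (intro Arg_ii_mult_of_real) (simp add: add_pos_pos)
  have lim: "boundary_arg a x l" if "Arg (\<i> * of_real (s * r - 1)) + pi / 2 = l" "s * r - 1 \<noteq> 0" for l
    using boundary_arg_large[of a x] assms(1) that(2) mult_pos_pos[OF s r] unfolding eq q that(1)
    by (auto simp: complex_nonpos_Reals_iff)
  show "boundary_arg a x pi" if "x < lambda_plus a"
  proof (rule lim)
    have "s * r - 1 > 0"
      using lambda_plus_cmp(1)[OF assms] that by (simp add: s_def r_def)
    then show "Arg (\<i> * of_real (s * r - 1)) + pi / 2 = pi" "s * r - 1 \<noteq> 0"
      using Arg_ii_mult_of_real(1)[of "s * r - 1"] by linarith+
  qed
  show "boundary_arg a x 0" if "x > lambda_plus a"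
  proof (rule lim)
    have "s * r - 1 < 0"
      using lambda_plus_cmp(2)[OF assms] that by (simp add: s_def r_def)
    then show "Arg (\<i> * of_real (s * r - 1)) + pi / 2 = 0" "s * r - 1 \<noteq> 0"
      using Arg_ii_mult_of_real(2)[of "s * r - 1"] by linarith+
  qed
qed

text \<open>Here \<open>1 - s w\<close> tends to zero, but \<open>(1 - s w) (1 - s / w) = - 2 s \<i> \<epsilon>\<close>, so its argument can be
  read off from the second factor.\<close>

lemma boundary_arg_eigenvalue:
  assumes "a\<^sup>2 > 2"
  shows "\<exists>l. boundary_arg a (lambda_plus a) l"
proof -
  define s where "s = sqrt (a\<^sup>2 - 1)"
  have s: "s > 1" "s\<^sup>2 = a\<^sup>2 - 1" using assms by (simp_all add: s_def)
  have \<lambda>: "2 * s * lambda_plus a = s\<^sup>2 + 1"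
    unfolding s(2) using s(1) by (simp add: lambda_plus_def s_def)
  have "0 \<le> (s - 1)\<^sup>2" by simp
  then have "2 * s * 1 \<le> 2 * s * lambda_plus a" unfolding \<lambda> by (simp add: power2_diff)
  then have ge: "lambda_plus a \<ge> 1" using s(1) by simp
  define r where "r = lambda_plus a - sqrt ((lambda_plus a)\<^sup>2 - 1)"
  have r: "0 < r" "r \<le> 1"
    using joukowski_inv_of_real_bounds[OF ge] by (simp_all add: r_def)
  have w0: "joukowski_inv (of_real (lambda_plus a)) = of_real r"
    unfolding r_def by (rule joukowski_inv_of_real[OF ge])
  let ?w = "\<lambda>\<epsilon>. joukowski_inv (Complex (lambda_plus a) \<epsilon>)"
  \<comment> \<open>This is the first rotated factor divided by \<epsilon>, as found by solving the
    product identity for it. Its limit at \<open>w = r\<close> is a positive real because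
    \<open>r \<le> 1 < s\<close>.\<close>
  let ?p = "\<lambda>w :: complex. of_real (2 * s) * w / (of_real s - w)" and ?q = "\<lambda>w. \<i> * (1 + of_real s * w)"
  have w: "(?w \<longlongrightarrow> of_real r) (at_right 0)"
    using tendsto_joukowski_inv_boundary[of "lambda_plus a"] unfolding w0 .
  have "?p (of_real r) = of_real (2 * s * r / (s - r))" by simp
  moreover have "2 * s * r / (s - r) > 0" using s r by simp
  moreover have "of_real s - of_real r \<noteq> (0 :: complex)"
    using s r by (simp flip: of_real_diff)
  ultimately have "?p (of_real r) \<notin> \<real>\<^sub>\<le>\<^sub>0" "of_real s - of_real r \<noteq> (0 :: complex)"
    unfolding complex_nonpos_Reals_iff by (metis Re_complex_of_real not_le)+
  moreover have "1 + s * r > 0" using s r by (simp add: add_pos_pos)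
  then have "?q (of_real r) \<notin> \<real>\<^sub>\<le>\<^sub>0" by (simp add: complex_nonpos_Reals_iff)
  ultimately have "((\<lambda>\<epsilon>. Arg (?p (?w \<epsilon>)) + Arg (?q (?w \<epsilon>))) \<longlongrightarrow> Arg (?p (of_real r)) + Arg (?q (of_real r))) (at_right 0)"
    by (intro tendsto_intros w)
  moreover have "argD a (Complex (lambda_plus a) \<epsilon>) = Arg (?p (?w \<epsilon>)) + Arg (?q (?w \<epsilon>))" if "\<epsilon> > 0" for \<epsilon>
  proof -
    let ?z = "Complex (lambda_plus a) \<epsilon>"
    have z: "Im ?z > 0" using that by simp
    have "of_real s - ?w \<epsilon> \<noteq> 0"
      using Im_joukowski_inv_neg[OF z] by (auto simp: complex_eq_iff)
    moreover have "- \<i> * (1 - of_real s * ?w \<epsilon>) * (of_real s - ?w \<epsilon>) = of_real \<epsilon> * (of_real (2 * s) * ?w \<epsilon>)"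
    proof -
      \<comment> \<open>Since \<open>lambda_plus a = z - \<i> \<epsilon>\<close>, the quadratic
        satisfied by \<open>s\<close> differs from the one satisfied by \<open>w\<close> only by a
        term in \<epsilon>; this term is all that survives in the product.\<close>
      have "2 * of_real s * ?z = of_real (2 * s * lambda_plus a) + 2 * of_real s * \<i> * of_real \<epsilon>"
        by (simp add: complex_eq_iff)
      then have s2: "(of_real s)\<^sup>2 + 1 = 2 * of_real s * ?z - 2 * of_real s * \<i> * of_real \<epsilon>"
        unfolding \<lambda> by simp
      have w2: "(?w \<epsilon>)\<^sup>2 + 1 = 2 * ?z * ?w \<epsilon>"
        by (rule joukowski_inv_quadratic) (use z in simp)
      have "(1 - of_real s * ?w \<epsilon>) * (of_real s - ?w \<epsilon>) = of_real s * ((?w \<epsilon>)\<^sup>2 + 1) - ?w \<epsilon> * ((of_real s)\<^sup>2 + 1)"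
        by (simp add: algebra_simps power2_eq_square)
      also have "\<dots> = \<i> * (of_real \<epsilon> * (of_real (2 * s) * ?w \<epsilon>))"
        unfolding s2 w2 by (simp add: algebra_simps)
      finally show ?thesis by (simp add: mult.assoc)
    qed
    ultimately have "- \<i> * (1 - of_real s * ?w \<epsilon>) = of_real \<epsilon> * ?p (?w \<epsilon>)"
      by (simp add: eq_divide_eq)
    moreover have "Arg (of_real \<epsilon> * ?p (?w \<epsilon>)) = Arg (?p (?w \<epsilon>))"
      using that by (rule Arg_times_of_real)
    moreover have "a\<^sup>2 > 1" using assms by simp
    ultimately show ?thesis
      using argD_large[OF _ z, of a] unfolding s_def by simp
  qed
  ultimately show ?thesis
    by (intro exI boundary_argI)
qed

section \<open>Convergence on the whole half line, and oddness\<close>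

lemma boundary_arg_exists:
  assumes "a \<noteq> 0" "x \<ge> 0"
  shows "\<exists>l. boundary_arg a x l"
proof (cases "a\<^sup>2 \<le> 2")
  case True
  then have a: "\<bar>a\<^sup>2 - 1\<bar> \<le> 1" by (auto simp: abs_le_iff)
  consider "x < 1" | "x \<ge> 1" "a\<^sup>2 < 2 \<or> x > 1" | "x = 1" "a\<^sup>2 = 2"
    using True by fastforce
  then show ?thesis
    by cases (use assms a boundary_arg_small_interior boundary_arg_small_exterior
        boundary_arg_threshold in blast)+
next
  case False
  then have a: "a\<^sup>2 > 2" "a\<^sup>2 > 1" by simp_all
  consider "x < 1" | "x \<ge> 1" "x < lambda_plus a" | "x \<ge> 1" "x > lambda_plus a" | "x = lambda_plus a"
    by fastforce
  then show ?thesis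
    by cases (use assms a boundary_arg_large_interior boundary_arg_large_exterior
        boundary_arg_eigenvalue in blast)+
qed

lemma ssf_odd:
  assumes "a \<noteq> 0"
  shows "ssf a (- x) = - ssf a x"
proof (cases "x \<ge> 0")
  case True
  then show ?thesis using boundary_arg_exists[OF assms] ssf_minus[OF assms] by blast
next
  case False
  then obtain l where "boundary_arg a (- x) l"
    using boundary_arg_exists[OF assms, of "- x"] by auto
  from ssf_minus[OF assms this] show ?thesis by simp
qed

theorem theorem4p3:
  fixes a :: real
  assumes "a > 0"
  shows "(\<forall>x. ssf a (- x) = - ssf a x) \<and>
    (a < sqrt 2 \<longrightarrow>
      (\<forall>x\<in>{0..<1}. ssf a x =
        1 / pi * arctan (2 * (a\<^sup>2 - 1) * x * sqrt (1 - x\<^sup>2) / (1 + (1 - a\<^sup>2) * (2 * x\<^sup>2 - 1)))) \<and>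
      (\<forall>x\<ge>1. ssf a x = 0)) \<and>
    (a > sqrt 2 \<longrightarrow>
      (\<forall>x\<in>{0<..<1}. ssf a x =
        1 / pi * arccot ((1 - (a\<^sup>2 - 1) * (2 * x\<^sup>2 - 1)) / (2 * (a\<^sup>2 - 1) * x * sqrt (1 - x\<^sup>2)))) \<and>
      ((\<lambda>x. 1 / pi * arccot ((1 - (a\<^sup>2 - 1) * (2 * x\<^sup>2 - 1)) / (2 * (a\<^sup>2 - 1) * x * sqrt (1 - x\<^sup>2))))
        \<longlongrightarrow> 0) (at_right 0) \<and>
      ssf a 0 = 0 \<and>
      (\<forall>x\<in>{1..<lambda_plus a}. ssf a x = 1) \<and>
      (\<forall>x>lambda_plus a. ssf a x = 0)) \<and>
    (a = sqrt 2 \<longrightarrow>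
      (\<forall>x\<in>{0..<1}. ssf a x = 1 / pi * arctan (x / sqrt (1 - x\<^sup>2))) \<and>
      (ssf a \<longlongrightarrow> 1 / 2) (at_left 1) \<and>
      (\<forall>x>1. ssf a x = 0))"
proof (intro conjI impI)
  have a0: "a \<noteq> 0" "a\<^sup>2 > 0" using assms by simp_all
  show odd: "\<forall>x. ssf a (- x) = - ssf a x" using ssf_odd[OF a0(1)] by blast
  {
    assume "a < sqrt 2"
    then have "a\<^sup>2 < (sqrt 2)\<^sup>2" using assms by (intro power_strict_mono) auto
    then have a: "a\<^sup>2 < 2" by simp
    then have a': "\<bar>a\<^sup>2 - 1\<bar> \<le> 1" using a0 by (auto simp: abs_le_iff)
    show "\<forall>x\<in>{0..<1}. ssf a x =
        1 / pi * arctan (2 * (a\<^sup>2 - 1) * x * sqrt (1 - x\<^sup>2) / (1 + (1 - a\<^sup>2) * (2 * x\<^sup>2 - 1)))"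
      by (intro ballI ssf_eqI boundary_arg_small_interior a0(1) a') auto
    show "\<forall>x\<ge>1. ssf a x = 0"
      using ssf_eqI[OF boundary_arg_small_exterior[OF a']] a by simp
  }
  {
    assume "a > sqrt 2"
    then have "a\<^sup>2 > (sqrt 2)\<^sup>2" by (intro power_strict_mono) auto
    then have a: "a\<^sup>2 > 2" "a\<^sup>2 > 1" by simp_all
    let ?N = "\<lambda>x. 1 - (a\<^sup>2 - 1) * (2 * x\<^sup>2 - 1)" and ?M = "\<lambda>x. 2 * (a\<^sup>2 - 1) * x * sqrt (1 - x\<^sup>2)"
    show "\<forall>x\<in>{0<..<1}. ssf a x = 1 / pi * arccot (?N x / ?M x)"
    proof
      fix x :: real assume "x \<in> {0<..<1}"
      then show "ssf a x = 1 / pi * arccot (?N x / ?M x)"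
        using boundary_arg_large_interior[OF a(2), of x] ssf_eqI[of a x] by auto
    qed
    have "(?N \<longlongrightarrow> 1 - (a\<^sup>2 - 1) * (2 * 0\<^sup>2 - 1)) (at_right 0)"
      by (intro tendsto_intros)
    then have N: "(?N \<longlongrightarrow> a\<^sup>2) (at_right 0)" by simp
    have "(?M \<longlongrightarrow> 2 * (a\<^sup>2 - 1) * 0 * sqrt (1 - 0\<^sup>2)) (at_right 0)"
      by (intro tendsto_intros)
    then have M: "(?M \<longlongrightarrow> 0) (at_right 0)" by simp
    have pos: "?M x > 0" if "x \<in> {0<..<1}" for x
      using that a by (simp add: abs_square_less_1)
    have "\<forall>\<^sub>F x in at_right 0. ?M x > 0"
      using eventually_at_right_real[of 0 1] by (rule eventually_mono[OF _ pos]) simp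
    with N M a0(2) have "filterlim (\<lambda>x. ?N x / ?M x) at_top (at_right 0)"
      by (intro LIM_at_top_divide)
    from filterlim_compose[OF tendsto_arctan_at_top this]
    have "((\<lambda>x. 1 / pi * (pi / 2 - arctan (?N x / ?M x))) \<longlongrightarrow> 1 / pi * (pi / 2 - pi / 2)) (at_right 0)"
      by (intro tendsto_mult tendsto_const tendsto_diff)
    then show "((\<lambda>x. 1 / pi * arccot (?N x / ?M x)) \<longlongrightarrow> 0) (at_right 0)"
      unfolding arccot_arctan by simp
    \<comment> \<open>At 0 the quotient is a division by zero with value 0, and
      \<open>arccot 0 = pi / 2\<close> would give the wrong number; oddness supplies the
      value.\<close>
    show "ssf a 0 = 0" using odd[rule_format, of 0] by simp
    show "\<forall>x\<in>{1..<lambda_plus a}. ssf a x = 1"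
      using ssf_eqI[OF boundary_arg_large_exterior(1)[OF a(1)]] by simp
    show "\<forall>x>lambda_plus a. ssf a x = 0"
    proof (intro allI impI)
      fix x assume x: "x > lambda_plus a"
      \<comment> \<open>The arithmetic-geometric mean inequality for \<open>s\<close> and
        \<open>1 / s\<close> puts the eigenvalue to the right of the cut, so points beyond it are
        exterior.\<close>
      have "lambda_plus a \<ge> 1"
      proof -
        define s where "s = sqrt (a\<^sup>2 - 1)"
        have s: "s > 0" "a\<^sup>2 = s\<^sup>2 + 1" using a by (simp_all add: s_def)
        have "0 \<le> (s - 1)\<^sup>2" by simp
        then have "2 * s \<le> s\<^sup>2 + 1" by (simp add: power2_diff)
        then show ?thesis unfolding lambda_plus_def s_def[symmetric] s(2) using s(1) by simp
      qed
      with x show "ssf a x = 0"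
        using ssf_eqI[OF boundary_arg_large_exterior(2)[OF a(1)], of x] by simp
    qed
  }
  {
    assume "a = sqrt 2"
    then have a: "a\<^sup>2 = 2" by simp
    then have a': "\<bar>a\<^sup>2 - 1\<bar> \<le> 1" by simp
    show int: "\<forall>x\<in>{0..<1}. ssf a x = 1 / pi * arctan (x / sqrt (1 - x\<^sup>2))"
    proof
      fix x :: real assume x: "x \<in> {0..<1}"
      then have "x\<^sup>2 < 1" by (simp add: abs_square_less_1)
      then have t: "sqrt (1 - x\<^sup>2) > 0" "1 + (1 - 2) * (2 * x\<^sup>2 - 1) = 2 * (sqrt (1 - x\<^sup>2) * sqrt (1 - x\<^sup>2))" by simp_all
      have "2 * (2 - 1) * x * sqrt (1 - x\<^sup>2) / (1 + (1 - 2) * (2 * x\<^sup>2 - 1)) = x / sqrt (1 - x\<^sup>2)"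
        unfolding t(2) using t(1) by (simp add: field_simps)
      then show "ssf a x = 1 / pi * arctan (x / sqrt (1 - x\<^sup>2))"
        using ssf_eqI[OF boundary_arg_small_interior[OF a0(1) a']] x unfolding a by simp
    qed
    \<comment> \<open>Rewriting the arctangent as \<open>arcsin x\<close> removes the blow-up of the
      quotient at 1: \<open>arcsin\<close> is continuous up to the end point.\<close>
    have arcsin_eq: "1 / pi * arcsin x = ssf a x" if "x \<in> {0<..<1}" for x
      using int that by (simp add: arcsin_arctan)
    have "continuous_on {-1..1} arcsin" by (rule continuous_on_arcsin')
    then have "(arcsin \<longlongrightarrow> arcsin 1) (at 1 within {-1..1})"
      unfolding continuous_on_def by (rule bspec) simp
    then have "(arcsin \<longlongrightarrow> pi / 2) (at_left 1)"
      by (simp add: at_within_Icc_at_left)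
    then have "((\<lambda>x. 1 / pi * arcsin x) \<longlongrightarrow> 1 / pi * (pi / 2)) (at_left 1)"
      by (rule tendsto_mult_left)
    moreover have "\<forall>\<^sub>F x in at_left 1. 1 / pi * arcsin x = ssf a x"
      using eventually_at_left_real[of 0 1]
      by (rule eventually_mono[OF _ arcsin_eq]) simp
    ultimately have "(ssf a \<longlongrightarrow> 1 / pi * (pi / 2)) (at_left 1)"
      by (rule Lim_transform_eventually)
    then show "(ssf a \<longlongrightarrow> 1 / 2) (at_left 1)" by simp
    show "\<forall>x>1. ssf a x = 0"
      using ssf_eqI[OF boundary_arg_small_exterior[OF a']] by simp
  }
qed

end
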